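(* Let $\mathcal{D}$ be a regular symmetric operator on a Hilbert $B$-module $E$. Then $\mathcal{D}$ is self-adjoint if and only if there exists an adequate approximate identity for $\mathcal{D}$.
   Context: A densely defined operator $S$ on a Hilbert $B$-module $E$ is semi-regular if $S^*$ is densely defined, and regular if moreover $S$ is closed and $1+S^*S$ has dense range. A sequential approximate identity on $E$ is a sequence of self-adjoint $\phi_k\in\mathrm{End}_B(E)$ converging strongly to the identity. For a symmetric $\mathcal{D}$, an adequate approximate identity for $\mathcal{D}$ is a sequential approximate identity with $\phi_k\cdot\mathrm{Dom}\,\mathcal{D}^*\subset\mathrm{Dom}\,\bar{\mathcal{D}}$, $[\bar{\mathcal{D}},\phi_k]$ bounded on $\mathrm{Dom}\,\mathcal{D}$ for all $k$, and $\sup_k\|\overline{[\bar{\mathcal{D}},\phi_k]}\|<\infty$. *)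

theory Defs
  imports "HOL-Analysis.Analysis"
begin

definition cstar_algebra :: "(complex \<Rightarrow> 'b::{banach,real_normed_algebra} \<Rightarrow> 'b) \<Rightarrow> ('b \<Rightarrow> 'b) \<Rightarrow> bool" where
  "cstar_algebra cB st \<longleftrightarrow>
     (\<forall>a. cB 1 a = a) \<and> (\<forall>c d a. cB c (cB d a) = cB (c * d) a) \<and>
     (\<forall>c a b. cB c (a + b) = cB c a + cB c b) \<and> (\<forall>c d a. cB (c + d) a = cB c a + cB d a) \<and>
     (\<forall>r a. cB (complex_of_real r) a = scaleR r a) \<and>
     (\<forall>c a. norm (cB c a) = norm c * norm a) \<and>
     (\<forall>c a b. cB c (a * b) = cB c a * b \<and> cB c (a * b) = a * cB c b) \<and>
     (\<forall>a b. st (a + b) = st a + st b) \<and> (\<forall>c a. st (cB c a) = cB (cnj c) (st a)) \<and>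
     (\<forall>a. st (st a) = a) \<and> (\<forall>a b. st (a * b) = st b * st a) \<and>
     (\<forall>a. norm (st a * a) = (norm a)\<^sup>2)"

definition cstar_positive :: "('b::{banach,real_normed_algebra} \<Rightarrow> 'b) \<Rightarrow> 'b \<Rightarrow> bool" where
  "cstar_positive st a \<longleftrightarrow> (\<exists>b. a = st b * b)"

text \<open>Hilbert B-module E (right module, inner product linear in the second variable).
  Completeness is given by the type class banach, whose norm is required to be the
  Hilbert-module norm sqrt(norm <x,x>).\<close>
definition hilbert_module ::
  "(complex \<Rightarrow> 'b::{banach,real_normed_algebra} \<Rightarrow> 'b) \<Rightarrow> ('b \<Rightarrow> 'b) \<Rightarrow>
   (complex \<Rightarrow> 'e::banach \<Rightarrow> 'e) \<Rightarrow> ('e \<Rightarrow> 'b \<Rightarrow> 'e) \<Rightarrow> ('e \<Rightarrow> 'e \<Rightarrow> 'b) \<Rightarrow> bool" where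
  "hilbert_module cB st cE act ip \<longleftrightarrow>
     cstar_algebra cB st \<and>
     (\<forall>x. cE 1 x = x) \<and> (\<forall>c d x. cE c (cE d x) = cE (c * d) x) \<and>
     (\<forall>c x y. cE c (x + y) = cE c x + cE c y) \<and> (\<forall>c d x. cE (c + d) x = cE c x + cE d x) \<and>
     (\<forall>r x. cE (complex_of_real r) x = scaleR r x) \<and>
     (\<forall>x a b. act (act x a) b = act x (a * b)) \<and>
     (\<forall>x y a. act (x + y) a = act x a + act y a) \<and>
     (\<forall>x a b. act x (a + b) = act x a + act x b) \<and>
     (\<forall>c x a. act (cE c x) a = cE c (act x a) \<and> act x (cB c a) = cE c (act x a)) \<and>
     (\<forall>x y z. ip x (y + z) = ip x y + ip x z) \<and>
     (\<forall>c x y. ip x (cE c y) = cB c (ip x y)) \<and>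
     (\<forall>x y a. ip x (act y a) = ip x y * a) \<and>
     (\<forall>x y. ip y x = st (ip x y)) \<and>
     (\<forall>x. cstar_positive st (ip x x)) \<and>
     (\<forall>x. ip x x = 0 \<longrightarrow> x = 0) \<and>
     (\<forall>x. norm x = sqrt (norm (ip x x)))"

text \<open>(Possibly unbounded) operators: a domain together with a map.\<close>
type_synonym 'e oper = "'e set \<times> ('e \<Rightarrow> 'e)"

definition is_operator :: "(complex \<Rightarrow> 'e::banach \<Rightarrow> 'e) \<Rightarrow> ('e \<Rightarrow> 'b \<Rightarrow> 'e) \<Rightarrow> 'e oper \<Rightarrow> bool" where
  "is_operator cE act T \<longleftrightarrow>
     0 \<in> fst T \<and>
     (\<forall>x\<in>fst T. \<forall>y\<in>fst T. x + y \<in> fst T \<and> snd T (x + y) = snd T x + snd T y) \<and>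
     (\<forall>x\<in>fst T. \<forall>c. cE c x \<in> fst T \<and> snd T (cE c x) = cE c (snd T x)) \<and>
     (\<forall>x\<in>fst T. \<forall>a. act x a \<in> fst T \<and> snd T (act x a) = act (snd T x) a)"

definition densely_defined :: "(complex \<Rightarrow> 'e::banach \<Rightarrow> 'e) \<Rightarrow> ('e \<Rightarrow> 'b \<Rightarrow> 'e) \<Rightarrow> 'e oper \<Rightarrow> bool" where
  "densely_defined cE act T \<longleftrightarrow> is_operator cE act T \<and> closure (fst T) = UNIV"

definition adjoint :: "('e \<Rightarrow> 'e \<Rightarrow> 'b) \<Rightarrow> 'e oper \<Rightarrow> 'e oper" where
  "adjoint ip T =
     ({y. \<exists>z. \<forall>x\<in>fst T. ip (snd T x) y = ip x z},
      \<lambda>y. SOME z. \<forall>x\<in>fst T. ip (snd T x) y = ip x z)"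

definition graph_of :: "'e oper \<Rightarrow> ('e \<times> 'e) set" where
  "graph_of T = {(x, snd T x) | x. x \<in> fst T}"

definition closed_op :: "'e::banach oper \<Rightarrow> bool" where
  "closed_op T \<longleftrightarrow> closed (graph_of T)"

definition op_closure :: "'e::banach oper \<Rightarrow> 'e oper" where
  "op_closure T =
     ({x. \<exists>y. (x, y) \<in> closure (graph_of T)}, \<lambda>x. THE y. (x, y) \<in> closure (graph_of T))"

definition semi_regular :: "(complex \<Rightarrow> 'e::banach \<Rightarrow> 'e) \<Rightarrow> ('e \<Rightarrow> 'b \<Rightarrow> 'e) \<Rightarrow> ('e \<Rightarrow> 'e \<Rightarrow> 'b) \<Rightarrow> 'e oper \<Rightarrow> bool" where
  "semi_regular cE act ip T \<longleftrightarrow> densely_defined cE act T \<and> densely_defined cE act (adjoint ip T)"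

definition regular :: "(complex \<Rightarrow> 'e::banach \<Rightarrow> 'e) \<Rightarrow> ('e \<Rightarrow> 'b \<Rightarrow> 'e) \<Rightarrow> ('e \<Rightarrow> 'e \<Rightarrow> 'b) \<Rightarrow> 'e oper \<Rightarrow> bool" where
  "regular cE act ip T \<longleftrightarrow> semi_regular cE act ip T \<and> closed_op T \<and>
     closure {x + snd (adjoint ip T) (snd T x) | x. x \<in> fst T \<and> snd T x \<in> fst (adjoint ip T)} = UNIV"

definition symmetric_op :: "(complex \<Rightarrow> 'e::banach \<Rightarrow> 'e) \<Rightarrow> ('e \<Rightarrow> 'b \<Rightarrow> 'e) \<Rightarrow> ('e \<Rightarrow> 'e \<Rightarrow> 'b) \<Rightarrow> 'e oper \<Rightarrow> bool" where
  "symmetric_op cE act ip T \<longleftrightarrow> densely_defined cE act T \<and>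
     fst T \<subseteq> fst (adjoint ip T) \<and> (\<forall>x\<in>fst T. snd (adjoint ip T) x = snd T x)"

definition self_adjoint_op :: "(complex \<Rightarrow> 'e::banach \<Rightarrow> 'e) \<Rightarrow> ('e \<Rightarrow> 'b \<Rightarrow> 'e) \<Rightarrow> ('e \<Rightarrow> 'e \<Rightarrow> 'b) \<Rightarrow> 'e oper \<Rightarrow> bool" where
  "self_adjoint_op cE act ip T \<longleftrightarrow> densely_defined cE act T \<and>
     fst (adjoint ip T) = fst T \<and> (\<forall>x\<in>fst T. snd (adjoint ip T) x = snd T x)"

definition adjointable :: "('e \<Rightarrow> 'e \<Rightarrow> 'b) \<Rightarrow> ('e \<Rightarrow> 'e) \<Rightarrow> bool" where
  "adjointable ip T \<longleftrightarrow> (\<exists>T'. \<forall>x y. ip (T x) y = ip x (T' y))"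

definition self_adjoint_end :: "('e \<Rightarrow> 'e \<Rightarrow> 'b) \<Rightarrow> ('e \<Rightarrow> 'e) \<Rightarrow> bool" where
  "self_adjoint_end ip T \<longleftrightarrow> adjointable ip T \<and> (\<forall>x y. ip (T x) y = ip x (T y))"

definition seq_approx_id :: "('e::banach \<Rightarrow> 'e \<Rightarrow> 'b) \<Rightarrow> (nat \<Rightarrow> 'e \<Rightarrow> 'e) \<Rightarrow> bool" where
  "seq_approx_id ip \<phi> \<longleftrightarrow> (\<forall>k. self_adjoint_end ip (\<phi> k)) \<and> (\<forall>x. (\<lambda>k. \<phi> k x) \<longlonglongrightarrow> x)"

definition bounded_on :: "'e::banach set \<Rightarrow> ('e \<Rightarrow> 'e) \<Rightarrow> bool" where
  "bounded_on S T \<longleftrightarrow> (\<exists>C. \<forall>x\<in>S. norm (T x) \<le> C * norm x)"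

definition op_norm :: "'e::banach oper \<Rightarrow> real" where
  "op_norm T = Sup {norm (snd T x) | x. x \<in> fst T \<and> norm x \<le> 1}"

text \<open>Commutator [closure D, phi], as a map defined on Dom D.\<close>
definition commutator :: "'e::banach oper \<Rightarrow> ('e \<Rightarrow> 'e) \<Rightarrow> 'e \<Rightarrow> 'e" where
  "commutator D \<phi> x = snd (op_closure D) (\<phi> x) - \<phi> (snd (op_closure D) x)"

definition adequate_approx_id :: "('e::banach \<Rightarrow> 'e \<Rightarrow> 'b) \<Rightarrow> 'e oper \<Rightarrow> (nat \<Rightarrow> 'e \<Rightarrow> 'e) \<Rightarrow> bool" where
  "adequate_approx_id ip D \<phi> \<longleftrightarrow>
     seq_approx_id ip \<phi> \<and>
     (\<forall>k. \<phi> k ` fst (adjoint ip D) \<subseteq> fst (op_closure D)) \<and>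
     (\<forall>k. bounded_on (fst D) (commutator D (\<phi> k))) \<and>
     bdd_above (range (\<lambda>k. op_norm (op_closure (fst D, commutator D (\<phi> k)))))"

end

theory Submission
  imports Defs "HOL-Computational_Algebra.Polynomial"
begin

text \<open>If \<open>D\<close> is self-adjoint, the constant sequence of identities is already adequate.

  Conversely, regularity makes \<open>1 + D\<^sup>* D\<close> and \<open>1 + D D\<^sup>*\<close> surjective, so the graph of \<open>D\<close> is
  complemented and \<open>D\<close> is self-adjoint as soon as \<open>D\<^sup>* a = b\<close>, \<open>D\<^sup>* b = -a\<close> forces \<open>a = 0\<close>.
  For such a pair \<open>\<langle>a, \<phi>\<^sub>k a\<rangle> + \<langle>b, D \<phi>\<^sub>k a\<rangle> = 0\<close>, and \<open>D \<phi>\<^sub>k a\<close> differs from \<open>\<phi>\<^sub>k b\<close> by a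
  sequence which is bounded because the commutators are uniformly bounded, and which is weakly null
  because it is so against \<open>Dom D\<close>. In the limit \<open>\<langle>a, a\<rangle> + \<langle>b, b\<rangle> = 0\<close>.

  What is needed from C*-algebra theory is \<open>\<parallel>a\<^sup>* a\<parallel> \<le> M \<parallel>a\<^sup>* a + b\<^sup>* b\<parallel>\<close> for some constant \<open>M\<close>.
  It is obtained without spectral theory (and without a unit): real polynomials of one self-adjoint
  element act on the algebra by left multiplication, and their operator norms satisfy \<open>\<parallel>f\<parallel>\<^sup>2 \<le> \<parallel>f\<^sup>2 + g\<^sup>2\<parallel>\<close>.\<close>

section \<open>Real polynomials acting by left multiplication\<close>

text \<open>Horner's scheme on maps rather than elements: a constant coefficient acts as a multiple
  of the identity map, which stands in for a unit.\<close>

definition pev :: "'b::real_normed_algebra \<Rightarrow> real poly \<Rightarrow> 'b \<Rightarrow> 'b" where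
  "pev p f = fold_coeffs (\<lambda>a T z. a *\<^sub>R z + p * T z) f (\<lambda>_. 0)"

lemma pev_0 [simp]: "pev p 0 z = 0"
  by (simp add: pev_def)

lemma pev_pCons [simp]: "pev p (pCons a f) z = a *\<^sub>R z + p * pev p f z"
  by (cases "f = 0 \<and> a = 0") (auto simp: pev_def)

lemma pev_add: "pev p (f + g) z = pev p f z + pev p g z"
  by (induction f g rule: poly_induct2) (simp_all add: algebra_simps)

lemma pev_smult: "pev p (smult a f) z = a *\<^sub>R pev p f z"
  by (induction f) (simp_all add: algebra_simps)

lemma pev_diff: "pev p (f - g) z = pev p f z - pev p g z"
  using pev_add[of p "f - g" g z] by simp

lemma pev_mult: "pev p (f * g) z = pev p f (pev p g z)"
  by (induction f) (simp_all add: pev_add pev_smult mult_pCons_left)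

lemma pev_1 [simp]: "pev p 1 z = z"
  by (simp add: one_pCons)

lemma bounded_linear_pev: "bounded_linear (pev p f)"
proof (induction f)
  case 0
  have "pev p 0 = (\<lambda>_. 0)" by auto
  then show ?case by simp
next
  case (pCons a f)
  have "pev p (pCons a f) = (\<lambda>z. a *\<^sub>R z + p * pev p f z)" by auto
  then show ?case
    using pCons.IH
    by (auto intro!: bounded_linear_add bounded_linear_scaleR_right bounded_linear_const_mult)
qed

section \<open>Operator norms of polynomials\<close>

definition pn :: "'b::real_normed_algebra \<Rightarrow> real poly \<Rightarrow> real" where
  "pn p f = onorm (pev p f)"

lemma pn_ge_0 [simp]: "0 \<le> pn p f"
  by (simp add: pn_def onorm_pos_le[OF bounded_linear_pev])

lemma norm_pev_le: "norm (pev p f z) \<le> pn p f * norm z"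
  by (simp add: pn_def onorm[OF bounded_linear_pev])

lemma pn_le: "0 \<le> c \<Longrightarrow> (\<And>z. norm (pev p f z) \<le> c * norm z) \<Longrightarrow> pn p f \<le> c"
  by (simp add: pn_def onorm_bound)

lemma pn_add: "pn p (f + g) \<le> pn p f + pn p g"
  by (rule pn_le) (auto simp: pev_add distrib_right intro!: norm_triangle_mono norm_pev_le)

lemma pn_diff: "pn p (f - g) \<le> pn p f + pn p g"
  by (rule pn_le) (auto simp: pev_diff distrib_right
      intro!: order_trans[OF norm_triangle_ineq4] add_mono norm_pev_le)

lemma pn_mult: "pn p (f * g) \<le> pn p f * pn p g"
proof (rule pn_le)
  fix z
  have "norm (pev p (f * g) z) \<le> pn p f * norm (pev p g z)"
    by (simp add: pev_mult norm_pev_le)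
  also have "\<dots> \<le> pn p f * (pn p g * norm z)"
    by (intro mult_left_mono norm_pev_le) simp
  finally show "norm (pev p (f * g) z) \<le> pn p f * pn p g * norm z" by (simp add: mult.assoc)
qed simp

lemma pn_smult: "pn p (smult a f) = \<bar>a\<bar> * pn p f"
proof -
  have "pev p (smult a f) = (\<lambda>z. a *\<^sub>R pev p f z)" by (auto simp: pev_smult)
  then show ?thesis by (simp add: pn_def onorm_scaleR[OF bounded_linear_pev])
qed

text \<open>An inequality only, because the identity map of the zero algebra has norm 0.\<close>

lemma pn_const: "0 \<le> a \<Longrightarrow> pn p [:a:] \<le> a"
  by (rule pn_le) simp_all

lemma pn_power: "pn p (f ^ n) \<le> pn p f ^ n"
proof (induction n)
  case 0
  show ?case using pn_const[of 1 p] by (simp add: one_pCons)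
next
  case (Suc n)
  have "pn p (f ^ Suc n) \<le> pn p f * pn p (f ^ n)" using pn_mult[of p f "f ^ n"] by simp
  also have "\<dots> \<le> pn p f * pn p f ^ n" by (intro mult_left_mono Suc) simp
  finally show ?case by simp
qed

text \<open>If \<open>a > \<rho>\<close>, then \<open>(a / \<rho>) ^ N\<close> outgrows every affine
  function of \<open>N\<close>, already along powers of two.\<close>

lemma exp_beats_affine:
  fixes a \<rho> K :: real
  assumes "\<rho> > 0" and *: "\<And>n. a ^ (2 ^ n) \<le> \<rho> ^ (2 ^ n) * (1 + 2 ^ n * K)"
  shows "a \<le> \<rho>"
proof (rule ccontr)
  assume "\<not> a \<le> \<rho>"
  define d where "d = a / \<rho> - 1"
  have d: "d > 0" using \<open>\<not> a \<le> \<rho>\<close> \<open>\<rho> > 0\<close> by (simp add: d_def)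
  have bound: "2 ^ n * d\<^sup>2 \<le> 2 * \<bar>K\<bar> + 1" for n :: nat
  proof -
    let ?N = "2 ^ n :: real"
    \<comment> \<open>Bernoulli alone is linear in the exponent; its square bounds the power with
      exponent \<open>2 ^ Suc n\<close> quadratically from below.\<close>
    have "1 + ?N * d \<le> (1 + d) ^ (2 ^ n)"
      using Bernoulli_inequality[of d "2 ^ n"] d by simp
    then have "(1 + ?N * d)\<^sup>2 \<le> ((1 + d) ^ (2 ^ n))\<^sup>2"
      using d by (intro power_mono) (auto simp: add_nonneg_nonneg)
    also have "\<dots> = (a / \<rho>) ^ (2 ^ Suc n)" by (simp add: d_def power_mult[symmetric] mult.commute)
    also have "\<dots> \<le> 1 + 2 ^ Suc n * K"
      using *[of "Suc n"] \<open>\<rho> > 0\<close> by (simp add: power_divide field_simps)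
    finally have "(?N * d)\<^sup>2 + 2 * ?N * d \<le> 2 * ?N * K" by (simp add: power2_sum)
    moreover have "(?N * d)\<^sup>2 = ?N * (?N * d\<^sup>2)" by (simp add: power2_eq_square)
    moreover have "0 \<le> 2 * ?N * d" "2 * ?N * K = ?N * (2 * K)" using d by simp_all
    ultimately have "?N * (?N * d\<^sup>2) \<le> ?N * (2 * K)" by linarith
    then have "?N * d\<^sup>2 \<le> 2 * K" by simp
    then show ?thesis by linarith
  qed
  obtain n where "(2 * \<bar>K\<bar> + 1) / d\<^sup>2 < 2 ^ n"
    using real_arch_pow[of 2] by force
  then show False using bound[of n] d by (simp add: field_simps)
qed

section \<open>C*-algebras\<close>

locale cstar =
  fixes cB :: "complex \<Rightarrow> 'b::{banach,real_normed_algebra} \<Rightarrow> 'b" and st :: "'b \<Rightarrow> 'b"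
  assumes cstar: "cstar_algebra cB st"
begin

section \<open>Rules for the involution and the complex scalars\<close>

lemma cB_one: "cB 1 a = a" and cB_cB: "cB c (cB d a) = cB (c * d) a"
  and cB_add: "cB c (a + b) = cB c a + cB c b" and cB_of_real: "cB (complex_of_real r) a = r *\<^sub>R a"
  and norm_cB: "norm (cB c a) = norm c * norm a"
  and st_add: "st (a + b) = st a + st b" and st_cB: "st (cB c a) = cB (cnj c) (st a)"
  and st_st [simp]: "st (st a) = a" and st_mult: "st (a * b) = st b * st a"
  and norm_st_mult: "norm (st a * a) = (norm a)\<^sup>2"
  by (simp_all only: cstar[unfolded cstar_algebra_def])

lemma cB_mult: "cB c (a * b) = cB c a * b \<and> cB c (a * b) = a * cB c b"
proof -
  have "\<forall>c a b. cB c (a * b) = cB c a * b \<and> cB c (a * b) = a * cB c b"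
    using cstar unfolding cstar_algebra_def by (elim conjE)
  then show ?thesis by blast
qed

lemma cB_mult_left: "cB c a * b = cB c (a * b)" and cB_mult_right: "a * cB c b = cB c (a * b)"
  by (simp_all add: cB_mult[THEN conjunct1, symmetric] cB_mult[THEN conjunct2, symmetric])

lemma st_scaleR: "st (r *\<^sub>R a) = r *\<^sub>R st a"
  using st_cB[of "complex_of_real r" a] by (simp add: cB_of_real)

lemma st_diff: "st (a - b) = st a - st b"
  using st_add[of "a - b" b] by simp

lemma cB_diff: "cB c (a - b) = cB c a - cB c b"
  using cB_add[of c "a - b" b] by simp

lemma cB_uminus: "cB (- 1) a = - a"
  using cB_of_real[of "-1" a] by simp

lemma st_0 [simp]: "st 0 = 0"
  using st_diff[of 0 0] by simp

lemma norm_st [simp]: "norm (st a) = norm a"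
proof -
  have le: "norm a \<le> norm (st a)" for a
  proof (cases "a = 0")
    case False
    have "norm a * norm a \<le> norm (st a) * norm a"
      using norm_mult_ineq[of "st a" a] by (simp add: norm_st_mult power2_eq_square)
    then show ?thesis using False by simp
  qed simp
  show ?thesis using le[of a] le[of "st a"] by simp
qed

text \<open>Symmetry of \<open>f(p)\<close> for the algebra-valued form \<open>st z * y\<close>; the
  induction step uses that \<open>p\<close> commutes with \<open>f(p)\<close>.\<close>

lemma st_pev_mult:
  assumes "st p = p" shows "st (pev p f z) * y = st z * pev p f y"
proof (induction f arbitrary: y)
  case 0
  then show ?case by simp
next
  case (pCons a f)
  have "st (pev p (pCons a f) z) * y = a *\<^sub>R (st z * y) + st (pev p f z) * (p * y)"
    by (simp add: st_add st_scaleR st_mult assms distrib_right mult.assoc)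
  also have "\<dots> = a *\<^sub>R (st z * y) + st z * pev p f (pev p [:0,1:] y)" by (simp add: pCons)
  also have "\<dots> = a *\<^sub>R (st z * y) + st z * pev p ([:0,1:] * f) y"
    by (simp only: pev_mult[symmetric] mult.commute[of f])
  finally show ?case by (simp add: distrib_left)
qed

text \<open>The operator \<open>w = f(p) + \<i> g(p)\<close> is normal with \<open>w\<^sup>* w = (f\<^sup>2 + g\<^sup>2)(p)\<close>, and
  \<open>2 f(p) = w + w\<^sup>*\<close>.\<close>
lemma pn_two_squares:
  assumes p: "st p = p" shows "(pn p f)\<^sup>2 \<le> pn p (f\<^sup>2 + g\<^sup>2)"
proof -
  let ?K = "pn p (f\<^sup>2 + g\<^sup>2)"
  have w: "norm (pev p f z + cB c (pev p g z)) \<le> sqrt ?K * norm z" if c: "c = \<i> \<or> c = - \<i>" for c z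
  proof -
    let ?u = "pev p f z" and ?v = "pev p g z"
    have cc: "cnj c = - c" "cnj c * c = 1" using c by auto
    have "st ?u * ?v = st z * pev p (f * g) z" "st ?v * ?u = st z * pev p (g * f) z"
      by (simp_all only: st_pev_mult[OF p] pev_mult)
    then have uv: "st ?u * ?v = st ?v * ?u" by (simp only: mult.commute[of f g])
    have neg: "cB (- c) x = - cB c x" for x
      using cB_cB[of "- 1" c x] by (simp only: cB_uminus) simp
    have "st (?u + cB c ?v) * (?u + cB c ?v) =
        st ?u * ?u + cB c (st ?u * ?v) + (cB (- c) (st ?v * ?u) + cB (cnj c * c) (st ?v * ?v))"
      by (simp only: st_add st_cB distrib_left distrib_right cB_mult_left cB_mult_right cB_add cB_cB cc(1)
          add.assoc) (simp add: ac_simps)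
    also have "\<dots> = st ?u * ?u + st ?v * ?v"
      by (simp only: uv cc(2) cB_one neg) simp
    also have "\<dots> = st z * pev p (f\<^sup>2 + g\<^sup>2) z"
      by (simp only: st_pev_mult[OF p] pev_mult pev_add distrib_left power2_eq_square)
    finally have "(norm (?u + cB c ?v))\<^sup>2 = norm (st z * pev p (f\<^sup>2 + g\<^sup>2) z)"
      by (simp only: norm_st_mult[symmetric])
    also have "\<dots> \<le> norm (st z) * norm (pev p (f\<^sup>2 + g\<^sup>2) z)" by (rule norm_mult_ineq)
    also have "\<dots> \<le> norm z * (?K * norm z)"
      unfolding norm_st by (intro mult_left_mono norm_pev_le norm_ge_zero)
    also have "\<dots> = (sqrt ?K * norm z)\<^sup>2" by (simp add: power_mult_distrib) (simp add: power2_eq_square)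
    finally show ?thesis by (rule power2_le_imp_le) simp
  qed
  have "pn p f \<le> sqrt ?K"
  proof (rule pn_le)
    fix z
    let ?u = "pev p f z" and ?v = "pev p g z"
    have "cB (- \<i>) ?v = - cB \<i> ?v" using cB_cB[of "- 1" \<i> ?v] by (simp only: cB_uminus) simp
    then have "2 *\<^sub>R ?u = (?u + cB \<i> ?v) + (?u + cB (- \<i>) ?v)" by (simp add: scaleR_2)
    moreover have "norm ((?u + cB \<i> ?v) + (?u + cB (- \<i>) ?v)) \<le> sqrt ?K * norm z + sqrt ?K * norm z"
      by (intro norm_triangle_mono w) auto
    ultimately have "norm (2 *\<^sub>R ?u) \<le> sqrt ?K * norm z + sqrt ?K * norm z" by simp
    then show "norm ?u \<le> sqrt ?K * norm z" by (simp add: mult.commute)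
  qed simp
  then have "(pn p f)\<^sup>2 \<le> (sqrt ?K)\<^sup>2" by (intro power_mono) auto
  then show ?thesis by simp
qed

lemma pn_power2: "st p = p \<Longrightarrow> pn p (f\<^sup>2) = (pn p f)\<^sup>2"
  using pn_two_squares[of p f 0] pn_power[of p f 2] by simp

lemma pn_power_two_power: "st p = p \<Longrightarrow> pn p (f ^ (2 ^ n)) = pn p f ^ (2 ^ n)"
proof (induction n)
  case (Suc n)
  then show ?case using pn_power2[of p "f ^ (2 ^ n)"] by (simp add: power_mult[symmetric] mult.commute)
qed simp

lemma norm_sq_selfadjoint: "st h = h \<Longrightarrow> norm (h * h) = (norm h)\<^sup>2"
  using norm_st_mult[of h] by simp

lemma norm_power4_selfadjoint: "st h = h \<Longrightarrow> norm (h * h * (h * h)) = (norm h) ^ 4"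
  using norm_st_mult[of "h * h"] by (simp add: st_mult norm_sq_selfadjoint)

lemma pn_X2:
  assumes h: "st h = h" shows "pn h [:0,0,1:] = (norm h)\<^sup>2"
proof (rule antisym)
  show "pn h [:0,0,1:] \<le> (norm h)\<^sup>2"
  proof (rule pn_le)
    fix z
    have "norm (h * (h * z)) \<le> norm h * (norm h * norm z)"
      by (meson mult_left_mono norm_ge_zero norm_mult_ineq order_trans)
    then show "norm (pev h [:0,0,1:] z) \<le> (norm h)\<^sup>2 * norm z"
      by (simp add: power2_eq_square)
  qed simp
  show "(norm h)\<^sup>2 \<le> pn h [:0,0,1:]"
  proof (cases "h = 0")
    case False
    \<comment> \<open>Test vector \<open>z = h * h\<close>: by the C*-identity its norm is
      \<open>(norm h)\<^sup>2\<close> and that of its image is \<open>norm h ^ 4\<close>.\<close>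
    have "(norm h) ^ 4 \<le> pn h [:0,0,1:] * (norm h)\<^sup>2"
      using norm_pev_le[of h "[:0,0,1:]" "h * h"] norm_power4_selfadjoint[OF h]
      by (simp add: norm_sq_selfadjoint[OF h] mult.assoc)
    then show ?thesis using False
      by (simp add: power4_eq_xxxx power2_eq_square)
  qed simp
qed

text \<open>For \<open>\<tau>\<^sup>2 = t\<close> the element \<open>g = \<tau> - x\<^sup>2 / (2\<tau>)\<close> is an approximate square root of \<open>t - x\<^sup>2\<close>, and
  \<open>\<parallel>g\<parallel>\<^sup>2 \<le> \<parallel>x\<^sup>2 + g\<^sup>2\<parallel>\<close> with \<open>x\<^sup>2 + g\<^sup>2 = t + x\<^sup>4 / (4t)\<close>.\<close>
lemma pn_const_minus_square:
  assumes x: "st x = x" and t: "t > 0"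
  shows "pn x [:t, 0, -1:] \<le> t + norm x ^ 4 / (2 * t)"
proof -
  define \<tau> where "\<tau> = sqrt t"
  have \<tau>: "\<tau> > 0" "t = \<tau>\<^sup>2" using t by (simp_all add: \<tau>_def)
  let ?g = "[:\<tau>, 0, - 1 / (2 * \<tau>):]" and ?q = "smult (1 / (4 * t)) ([:0,0,1:]\<^sup>2)"
  have q: "pn x ?q = norm x ^ 4 / (4 * t)"
    using t by (simp add: pn_smult pn_power2[OF x] pn_X2[OF x] del: mult_pCons_left power2_eq_square)
  have 1: "?g\<^sup>2 + [:0,1:]\<^sup>2 = [:t:] + ?q"
    using \<tau> by (simp add: power2_eq_square field_simps)
  have 2: "[:t, 0, -1:] = ?g\<^sup>2 - ?q"
    using \<tau> by (simp add: power2_eq_square field_simps)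
  have "pn x (?g\<^sup>2) \<le> pn x ([:t:] + ?q)"
    using pn_two_squares[OF x, of ?g "[:0,1:]"] unfolding pn_power2[OF x] 1 .
  also have "\<dots> \<le> t + norm x ^ 4 / (4 * t)"
    using pn_add[of x "[:t:]" ?q] pn_const[of t x] t unfolding q by linarith
  finally have "pn x [:t, 0, -1:] \<le> t + norm x ^ 4 / (4 * t) + norm x ^ 4 / (4 * t)"
    using pn_diff[of x "?g\<^sup>2" ?q] unfolding 2 q by linarith
  then show ?thesis by simp
qed

text \<open>The Kelley-Vaught step: \<open>c\<^sup>* f(c c\<^sup>*) c = (X f)(c\<^sup>* c)\<close> transports bounds on powers of
  \<open>t - c c\<^sup>*\<close> to powers of \<open>t - c\<^sup>* c\<close> up to a factor linear in the exponent.\<close>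
lemma pn_shift_swap:
  assumes t: "0 < t" "t \<le> \<rho>" and r: "pn (c * st c) [:t, -1:] \<le> \<rho>"
  shows "pn (st c * c) [:t, -1:] \<le> \<rho>"
proof -
  let ?q = "st c * c" and ?r = "c * st c" and ?f = "[:t, -1:]"
  define K where "K = (norm c)\<^sup>2 / \<rho>"
  have \<rho>: "\<rho> > 0" and K: "K \<ge> 0" using t by (auto simp: K_def)
  have q: "st ?q = ?q" by (simp add: st_mult)
  have intertwine: "st c * pev ?r f (c * z) = pev ?q ([:0,1:] * f) z" for f z
    unfolding mult.commute[of "[:0,1:]"] pev_mult
    by (induction f arbitrary: z) (simp_all add: distrib_left mult.assoc)
  have Xf: "pn ?q ([:0,1:] * ?f ^ n) \<le> (norm c)\<^sup>2 * \<rho> ^ n" for n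
  proof (rule pn_le)
    fix z
    have "norm (pev ?q ([:0,1:] * ?f ^ n) z) \<le> norm c * norm (pev ?r (?f ^ n) (c * z))"
      using norm_mult_ineq[of "st c" "pev ?r (?f ^ n) (c * z)"] unfolding intertwine by simp
    also have "\<dots> \<le> norm c * (\<rho> ^ n * (norm c * norm z))"
    proof (intro mult_left_mono order_trans[OF norm_pev_le mult_mono])
      show "pn ?r (?f ^ n) \<le> \<rho> ^ n"
        using pn_power[of ?r ?f n] power_mono[OF r, of n] by simp
    qed (use \<rho> norm_mult_ineq in auto)
    finally show "norm (pev ?q ([:0,1:] * ?f ^ n) z) \<le> (norm c)\<^sup>2 * \<rho> ^ n * norm z"
      by (simp only: power2_eq_square ac_simps)
  qed (use \<rho> in simp)
  have "pn ?q (?f ^ N) \<le> \<rho> ^ N * (1 + real N * K)" for N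
  proof (induction N)
    case 0
    show ?case using pn_const[of 1 ?q] by (simp add: one_pCons)
  next
    case (Suc N)
    \<comment> \<open>Peel off one factor \<open>t - X\<close>: the part with \<open>X\<close> is
      controlled by \<open>Xf\<close>, so each step adds only \<open>K\<close> to the affine
      factor.\<close>
    have "?f ^ Suc N = smult t (?f ^ N) - [:0,1:] * ?f ^ N" by simp
    then have "pn ?q (?f ^ Suc N) \<le> t * pn ?q (?f ^ N) + pn ?q ([:0,1:] * ?f ^ N)"
      using pn_diff[of ?q "smult t (?f ^ N)"] t by (simp only: pn_smult) simp
    also have "\<dots> \<le> \<rho> * (\<rho> ^ N * (1 + real N * K)) + (norm c)\<^sup>2 * \<rho> ^ N"
      using t Suc Xf[of N] by (intro add_mono mult_mono) auto
    also have "(norm c)\<^sup>2 = K * \<rho>" using \<rho> by (simp add: K_def)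
    finally show ?case by (simp add: algebra_simps)
  qed
  \<comment> \<open>Along exponents \<open>2 ^ n\<close> the norm is exactly multiplicative, and
    taking roots removes the affine factor.\<close>
  from this[of "2 ^ n" for n] show ?thesis
    unfolding pn_power_two_power[OF q] by (intro exp_beats_affine[OF \<rho>]) simp
qed


text \<open>The lowest term of the binomial expansion of the difference is
  \<open>2 n T ^ (n - 1) X\<^sup>2\<close>. All coefficients are nonnegative, so the rest is bounded
  in norm by its value with \<open>(norm h)\<^sup>2\<close> in place of
  \<open>X\<^sup>2\<close>.\<close>

lemma pn_odd_part_lower:
  assumes h: "st h = h" and T: "0 \<le> T"
  shows "4 * real n * T ^ (n - 1) * (norm h)\<^sup>2 - ((T + (norm h)\<^sup>2) ^ n - (T - (norm h)\<^sup>2) ^ n)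
      \<le> pn h ([:T,0,1:] ^ n - [:T,0,-1:] ^ n)"
proof -
  define F where "F = ([:0,0,1:] :: real poly)"
  define A where "A = ([:T,0,1:] :: real poly)"
  define B where "B = ([:T,0,-1:] :: real poly)"
  define \<phi> where "\<phi> = (norm h)\<^sup>2"
  define e where "e n = 2 * real n * T ^ (n - 1)" for n
  have F: "pn h F = \<phi>" by (simp add: F_def \<phi>_def pn_X2[OF h])
  have \<phi>: "\<phi> \<ge> 0" by (simp add: \<phi>_def)
  have A: "A * x = smult T x + F * x" and B: "B * x = smult T x - F * x" for x
    by (simp_all add: A_def B_def F_def)
  have e_Suc: "e (Suc n) = T * e n + 2 * T ^ n" for n
    by (cases n) (simp_all add: e_def algebra_simps)
  have e0: "e n \<ge> 0" for n using T by (simp add: e_def)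
  \<comment> \<open>Multiplying by \<open>F\<close> exchanges the odd part
    \<open>A ^ n - B ^ n\<close> and the even part \<open>A ^ n + B ^ n\<close>, so the induction
    carries both, each without its lowest term.\<close>
  have claim: "pn h (A ^ n - B ^ n - smult (e n) F) \<le> (T + \<phi>) ^ n - (T - \<phi>) ^ n - e n * \<phi> \<and>
      pn h (A ^ n + B ^ n - smult (2 * T ^ n) 1) \<le> (T + \<phi>) ^ n + (T - \<phi>) ^ n - 2 * T ^ n"
  proof (induction n)
    case 0
    have "(1::real poly) + 1 - smult 2 1 = 0" by (simp add: one_pCons)
    then show ?case using pn_smult[of h 0 0] by (simp add: e_def)
  next
    case (Suc n)
    let ?S = "A ^ n - B ^ n" and ?C = "A ^ n + B ^ n"
    let ?s = "(T + \<phi>) ^ n - (T - \<phi>) ^ n" and ?c = "(T + \<phi>) ^ n + (T - \<phi>) ^ n"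
    have 1: "A ^ Suc n - B ^ Suc n - smult (e (Suc n)) F =
        smult T (?S - smult (e n) F) + F * (?C - smult (2 * T ^ n) 1)"
      unfolding e_Suc by (simp add: A B smult_diff_right smult_add_right smult_add_left algebra_simps)
    have 2: "A ^ Suc n + B ^ Suc n - smult (2 * T ^ Suc n) 1 =
        smult T (?C - smult (2 * T ^ n) 1) + F * ?S"
      by (simp add: A B smult_diff_right smult_add_right smult_add_left algebra_simps)
    have "pn h ?S \<le> pn h (?S - smult (e n) F) + pn h (smult (e n) F)"
      using pn_add[of h "?S - smult (e n) F" "smult (e n) F"] by simp
    also have "\<dots> \<le> ?s" using Suc e0[of n] by (simp add: pn_smult F)
    finally have S: "pn h ?S \<le> ?s" .
    have TS: "T * pn h (?S - smult (e n) F) \<le> T * (?s - e n * \<phi>)"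
      and TC: "T * pn h (?C - smult (2 * T ^ n) 1) \<le> T * (?c - 2 * T ^ n)"
      and FC: "\<phi> * pn h (?C - smult (2 * T ^ n) 1) \<le> \<phi> * (?c - 2 * T ^ n)"
      and FS: "\<phi> * pn h ?S \<le> \<phi> * ?s"
      using Suc S T \<phi> by (auto intro: mult_left_mono)
    have "pn h (A ^ Suc n - B ^ Suc n - smult (e (Suc n)) F) \<le>
        T * (?s - e n * \<phi>) + \<phi> * (?c - 2 * T ^ n)"
      unfolding 1 using pn_add[of h "smult T (?S - smult (e n) F)" "F * (?C - smult (2 * T ^ n) 1)"]
        pn_mult[of h F "?C - smult (2 * T ^ n) 1"] TS FC T
      unfolding pn_smult F by simp
    moreover have "pn h (A ^ Suc n + B ^ Suc n - smult (2 * T ^ Suc n) 1) \<le>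
        T * (?c - 2 * T ^ n) + \<phi> * ?s"
      unfolding 2 using pn_add[of h "smult T (?C - smult (2 * T ^ n) 1)" "F * ?S"]
        pn_mult[of h F ?S] TC FS T
      unfolding pn_smult F by simp
    ultimately show ?case unfolding e_Suc by (simp add: algebra_simps)
  qed
  \<comment> \<open>Reverse triangle inequality. The remainder bound contains
    \<open>- e n * \<phi>\<close>, so the lowest term counts twice and gets the factor 4.\<close>
  have "e n * \<phi> = pn h (smult (e n) F)" using e0[of n] by (simp add: pn_smult F)
  also have "\<dots> \<le> pn h (A ^ n - B ^ n) + pn h (A ^ n - B ^ n - smult (e n) F)"
    using pn_diff[of h "A ^ n - B ^ n" "A ^ n - B ^ n - smult (e n) F"] by simp
  finally show ?thesis using claim by (simp add: A_def B_def e_def \<phi>_def)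
qed

text \<open>For even \<open>m\<close> and \<open>A = T + h\<^sup>2\<close>, \<open>B = T - h\<^sup>2\<close>, the identity
  \<open>(A\<^sup>m - B\<^sup>m)\<^sup>2 + 2 (A B)\<^sup>m = A\<^bsup>2m\<^esup> + B\<^bsup>2m\<^esup>\<close> bounds \<open>A\<^sup>m - B\<^sup>m\<close> by \<open>\<surd>2 T\<^sup>m\<close> up to the
  defect \<open>\<delta>\<close>, whereas for \<open>T = m \<parallel>h\<parallel>\<^sup>2\<close> it has norm at least about \<open>(4 - 2 sinh 1) T\<^sup>m > \<surd>2 T\<^sup>m\<close>.\<close>
lemma norm_sq_le_of_shifts:
  assumes h: "st h = h" and k: "k > 0" and T: "T = 2 * real k * (norm h)\<^sup>2" and \<delta>: "0 \<le> \<delta>"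
    and A: "pn h [:T,0,1:] \<le> T + \<delta>" and B: "pn h [:T,0,-1:] \<le> T + \<delta>"
  shows "(norm h)\<^sup>2 \<le> 16 * \<delta>"
proof (rule ccontr)
  assume not: "\<not> (norm h)\<^sup>2 \<le> 16 * \<delta>"
  define \<phi> where "\<phi> = (norm h)\<^sup>2"
  define m where "m = 2 * k"
  let ?A = "[:T,0,1:]" and ?B = "[:T,0,-1:]"
  have \<phi>: "\<phi> > 16 * \<delta>" "\<phi> > 0" using not \<delta> by (auto simp: \<phi>_def)
  have m: "m \<ge> 2" and Tm: "T = real m * \<phi>" using k T by (simp_all add: m_def \<phi>_def)
  have T0: "T > 0" using \<phi> m Tm by simp
  have \<phi>T: "\<phi> = T * (1 / real m)" using Tm m by simp
  have T_Suc: "T ^ m = T * T ^ (m - 1)" using m by (cases m) auto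
  have "(1 + 1 / real m) ^ m \<le> exp 1"
    using exp_ge_one_plus_x_over_n_power_n[where n = m and x = 1] m by simp
  then have e: "(1 + 1 / real m) ^ m < 2.72" using e_less_272 by simp
  \<comment> \<open>Bernoulli at exponent \<open>m\<close> gives only 0; at \<open>k = m / 2\<close>
    it gives 1/2, which is then squared.\<close>
  have "1 / 2 \<le> (1 - 1 / real m) ^ k"
    using Bernoulli_inequality[of "- 1 / real m" k] m k by (simp add: m_def field_simps)
  then have "(1 / 2)\<^sup>2 \<le> ((1 - 1 / real m) ^ k)\<^sup>2" by (intro power_mono) auto
  then have e': "1 / 4 \<le> (1 - 1 / real m) ^ m"
    by (simp add: m_def power_mult[symmetric] mult.commute power_one_over)
  have "(T + \<phi>) ^ m = T ^ m * (1 + 1 / real m) ^ m" "(T - \<phi>) ^ m = T ^ m * (1 - 1 / real m) ^ m"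
    unfolding power_mult_distrib[symmetric] by (simp_all add: \<phi>T algebra_simps)
  moreover have "4 * real m * T ^ (m - 1) * \<phi> = 4 * T ^ m" unfolding T_Suc by (simp add: Tm)
  ultimately have "T ^ m * (4 - (1 + 1 / real m) ^ m + (1 - 1 / real m) ^ m) \<le> pn h (?A ^ m - ?B ^ m)"
    using pn_odd_part_lower[OF h, of T m] T0 unfolding \<phi>_def[symmetric] by (simp add: algebra_simps)
  \<comment> \<open>4 - 2.72 + 1/4 = 1.53.\<close>
  moreover have "T ^ m * 1.53 \<le> T ^ m * (4 - (1 + 1 / real m) ^ m + (1 - 1 / real m) ^ m)"
    using e e' T0 by (intro mult_left_mono) auto
  ultimately have "T ^ m * 1.53 \<le> pn h (?A ^ m - ?B ^ m)" by linarith
  then have "(T ^ m * 1.53)\<^sup>2 \<le> (pn h (?A ^ m - ?B ^ m))\<^sup>2" using T0 by (intro power_mono) auto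
  \<comment> \<open>Since \<open>m = 2 * k\<close>, the term \<open>2 (A B) ^ m\<close> is the
    square of a real polynomial, as \<open>pn_two_squares\<close> demands.\<close>
  also have "\<dots> \<le> pn h ((?A ^ m - ?B ^ m)\<^sup>2 + (smult (sqrt 2) ((?A * ?B) ^ k))\<^sup>2)"
    by (rule pn_two_squares[OF h])
  also have "(?A ^ m - ?B ^ m)\<^sup>2 + (smult (sqrt 2) ((?A * ?B) ^ k))\<^sup>2 = ?A ^ (2 * m) + ?B ^ (2 * m)"
  proof -
    have "(smult (sqrt 2) ((?A * ?B) ^ k))\<^sup>2 = smult 2 (?A ^ m * ?B ^ m)"
    proof -
      have "(smult (sqrt 2) p)\<^sup>2 = smult 2 (p\<^sup>2)" for p :: "real poly" by (simp add: power2_eq_square)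
      then show ?thesis by (simp only: m_def power_mult_distrib power_mult[symmetric] mult.commute[of 2])
    qed
    moreover have "(x - y)\<^sup>2 + smult 2 (x * y) = x\<^sup>2 + y\<^sup>2" for x y :: "real poly"
      by (simp only: power2_diff mult.assoc) (simp add: numeral_poly)
    ultimately show ?thesis by (simp only: power_mult[symmetric] mult.commute[of 2])
  qed
  also have "pn h \<dots> \<le> (T + \<delta>) ^ (2 * m) + (T + \<delta>) ^ (2 * m)"
    by (intro order_trans[OF pn_add] add_mono order_trans[OF pn_power] power_mono A B) auto
  also have "\<dots> = 2 * ((T ^ m)\<^sup>2 * (1 + \<delta> / T) ^ (2 * m))"
  proof -
    have "T + \<delta> = T * (1 + \<delta> / T)" using T0 by (simp add: field_simps)
    then show ?thesis by (simp only: power_mult_distrib) (simp add: power_mult[symmetric] mult.commute)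
  qed
  finally have "(T ^ m)\<^sup>2 * 1.53\<^sup>2 \<le> (T ^ m)\<^sup>2 * (2 * (1 + \<delta> / T) ^ (2 * m))"
    by (simp only: power_mult_distrib mult_ac)
  then have low: "1.53\<^sup>2 \<le> 2 * (1 + \<delta> / T) ^ (2 * m)" using T0 by simp
  \<comment> \<open>From \<open>16 * \<delta> < \<phi>\<close> and
    \<open>T = m * \<phi>\<close>.\<close>
  have "\<delta> / T \<le> (1 / 8) / real (2 * m)"
    using \<phi> m by (simp add: Tm field_simps)
  then have "(1 + \<delta> / T) ^ (2 * m) \<le> (1 + (1 / 8) / real (2 * m)) ^ (2 * m)"
    using \<delta> T0 by (intro power_mono) (auto simp: add_nonneg_nonneg)
  also have "\<dots> \<le> exp (1 / 8)"
    using exp_ge_one_plus_x_over_n_power_n[where n = "2 * m" and x = "1 / 8"] m by simp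
  also have "\<dots> \<le> 1 + 1 / 8 + (1 / 8)\<^sup>2" by (rule exp_bound) auto
  \<comment> \<open>2 (1 + 1/8 + 1/64) = 2.28125 is below 1.53 squared, which is 2.3409.\<close>
  finally show False using low by (simp add: power2_eq_square)
qed

section \<open>Positivity up to an error\<close>

text \<open>For self-adjoint \<open>a\<close> this expresses \<open>a \<ge> - \<epsilon>\<close> by
  norms alone: for large \<open>t\<close> the norm of \<open>t - a\<close> is \<open>t\<close> minus
  the least spectral value of \<open>a\<close>. The slack \<open>\<eta>\<close> absorbs errors that
  vanish as \<open>t\<close> grows.\<close>

definition almost_positive :: "'b \<Rightarrow> real \<Rightarrow> bool" where
  "almost_positive a \<epsilon> \<longleftrightarrow> (\<forall>\<eta>>0. \<exists>t0. \<forall>t\<ge>t0. \<forall>z. norm (t *\<^sub>R z - a * z) \<le> (t + \<epsilon> + \<eta>) * norm z)"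

lemma almost_positive_square:
  assumes "st x = x" shows "almost_positive (x * x) 0"
  unfolding almost_positive_def
proof (intro allI impI)
  fix \<eta> :: real assume \<eta>: "\<eta> > 0"
  have "norm (t *\<^sub>R z - x * x * z) \<le> (t + 0 + \<eta>) * norm z" if t: "max 1 (norm x ^ 4 / (2 * \<eta>)) \<le> t" for t z
  proof -
    have "norm x ^ 4 / (2 * t) \<le> \<eta>" using t \<eta> by (simp add: field_simps)
    then have "pn x [:t, 0, -1:] \<le> t + \<eta>" using pn_const_minus_square[OF assms, of t] t by linarith
    then have "pn x [:t, 0, -1:] * norm z \<le> (t + \<eta>) * norm z" by (simp add: mult_right_mono)
    then show ?thesis using norm_pev_le[of x "[:t, 0, -1:]" z] by (simp add: mult.assoc)
  qed
  then show "\<exists>t0. \<forall>t\<ge>t0. \<forall>z. norm (t *\<^sub>R z - x * x * z) \<le> (t + 0 + \<eta>) * norm z" by blast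
qed

lemma almost_positive_add:
  assumes "almost_positive a \<epsilon>" "almost_positive b \<epsilon>'"
  shows "almost_positive (a + b) (\<epsilon> + \<epsilon>')"
  unfolding almost_positive_def
proof (intro allI impI)
  fix \<eta> :: real assume \<eta>: "\<eta> > 0"
  then obtain s where s: "norm (t *\<^sub>R z - a * z) \<le> (t + \<epsilon> + \<eta> / 2) * norm z" if "t \<ge> s" for t z
    using assms(1) half_gt_zero[OF \<eta>] unfolding almost_positive_def by blast
  obtain s' where s': "norm (t *\<^sub>R z - b * z) \<le> (t + \<epsilon>' + \<eta> / 2) * norm z" if "t \<ge> s'" for t z
    using assms(2) half_gt_zero[OF \<eta>] unfolding almost_positive_def by blast
  have "norm (t *\<^sub>R z - (a + b) * z) \<le> (t + (\<epsilon> + \<epsilon>') + \<eta>) * norm z" if "t \<ge> 2 * max s s'" for t z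
  proof -
    \<comment> \<open>Half of \<open>t\<close> goes to each summand, so the errors simply
      add.\<close>
    have "t *\<^sub>R z = (t / 2) *\<^sub>R z + (t / 2) *\<^sub>R z" by (simp add: scaleR_add_left[symmetric])
    then have "t *\<^sub>R z - (a + b) * z = ((t / 2) *\<^sub>R z - a * z) + ((t / 2) *\<^sub>R z - b * z)"
      by (simp add: distrib_right)
    also have "norm \<dots> \<le> (t / 2 + \<epsilon> + \<eta> / 2) * norm z + (t / 2 + \<epsilon>' + \<eta> / 2) * norm z"
      using that by (intro norm_triangle_mono s s') auto
    finally show ?thesis by (simp add: field_simps)
  qed
  then show "\<exists>t0. \<forall>t\<ge>t0. \<forall>z. norm (t *\<^sub>R z - (a + b) * z) \<le> (t + (\<epsilon> + \<epsilon>') + \<eta>) * norm z" by blast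
qed

lemma almost_positive_norm: "almost_positive a (norm a)"
  unfolding almost_positive_def
proof (intro allI impI exI[of _ 0])
  fix \<eta> t z assume "(0::real) < \<eta>" "(0::real) \<le> t"
  then have "norm (t *\<^sub>R z - a * z) \<le> t * norm z + norm a * norm z"
    using norm_triangle_ineq4[of "t *\<^sub>R z" "a * z"] norm_mult_ineq[of a z] by simp
  also have "\<dots> \<le> (t + norm a + \<eta>) * norm z"
    using \<open>0 < \<eta>\<close> by (simp add: distrib_right)
  finally show "norm (t *\<^sub>R z - a * z) \<le> (t + norm a + \<eta>) * norm z" .
qed

text \<open>\<open>pn_shift_swap\<close> with \<open>\<rho> = t + \<epsilon> + \<eta>\<close>;
  \<open>\<epsilon> \<ge> 0\<close> secures \<open>t \<le> \<rho>\<close>.\<close>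

lemma almost_positive_swap:
  assumes "almost_positive (c * st c) \<epsilon>" "\<epsilon> \<ge> 0" shows "almost_positive (st c * c) \<epsilon>"
  unfolding almost_positive_def
proof (intro allI impI)
  fix \<eta> :: real assume \<eta>: "\<eta> > 0"
  then obtain t0 where t0: "norm (t *\<^sub>R z - (c * st c) * z) \<le> (t + \<epsilon> + \<eta>) * norm z" if "t \<ge> t0" for t z
    using assms(1) unfolding almost_positive_def by blast
  have "norm (t *\<^sub>R z - (st c * c) * z) \<le> (t + \<epsilon> + \<eta>) * norm z" if t: "t \<ge> max 1 t0" for t z
  proof -
    have "pn (c * st c) [:t, -1:] \<le> t + \<epsilon> + \<eta>"
      using t0[of t] t assms(2) \<eta> by (intro pn_le) auto
    then have "pn (st c * c) [:t, -1:] \<le> t + \<epsilon> + \<eta>"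
      using t assms(2) \<eta> by (intro pn_shift_swap) auto
    then have "pn (st c * c) [:t, -1:] * norm z \<le> (t + \<epsilon> + \<eta>) * norm z" by (simp add: mult_right_mono)
    then show ?thesis using norm_pev_le[of "st c * c" "[:t, -1:]" z] by simp
  qed
  then show "\<exists>t0. \<forall>t\<ge>t0. \<forall>z. norm (t *\<^sub>R z - st c * c * z) \<le> (t + \<epsilon> + \<eta>) * norm z" by blast
qed

text \<open>Up to sign, \<open>x\<close> and \<open>y\<close> are the real and imaginary parts of
  \<open>c\<close>. Doubled squares are written as sums to fit
  \<open>almost_positive_add\<close>.\<close>

lemma mult_st_swap_decompose:
  obtains x y where "st x = x" "st y = y" "st c * c + c * st c = (x * x + x * x) + (y * y + y * y)"
proof
  let ?x = "(1/2) *\<^sub>R (c + st c)" and ?d = "(1/2) *\<^sub>R (c - st c)"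
  let ?y = "cB \<i> ?d"
  show "st ?x = ?x" by (simp add: st_scaleR st_add add.commute)
  have "st ?d = - ?d" by (simp add: st_scaleR st_diff scaleR_diff_right)
  then have "st ?y = cB (- \<i>) (cB (- 1) ?d)" by (simp only: st_cB cB_uminus complex_cnj_i)
  then show "st ?y = ?y" by (simp add: cB_cB)
  have "?y * ?y = cB (\<i> * \<i>) (?d * ?d)" by (simp only: cB_mult_left cB_mult_right cB_cB)
  then have y: "?y * ?y = - (?d * ?d)" by (simp add: cB_uminus)
  have dd: "(1/4) *\<^sub>R w + (1/4) *\<^sub>R w = (1/2) *\<^sub>R w" for w :: 'b by (simp add: scaleR_add_left[symmetric])
  have dd2: "(1/2) *\<^sub>R w + (1/2) *\<^sub>R w = w" for w :: 'b by (simp add: scaleR_add_left[symmetric])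
  have "(?x * ?x + ?x * ?x) + (?y * ?y + ?y * ?y) =
      (1/2) *\<^sub>R ((c + st c) * (c + st c)) - (1/2) *\<^sub>R ((c - st c) * (c - st c))"
    unfolding y using dd[of "(c + st c) * (c + st c)"] dd[of "- ((c - st c) * (c - st c))"]
    by simp
  also have "\<dots> = (1/2) *\<^sub>R ((st c * c + c * st c) + (st c * c + c * st c))"
    unfolding scaleR_diff_right[symmetric] by (simp add: algebra_simps)
  also have "\<dots> = st c * c + c * st c" unfolding scaleR_add_right[of _ "st c * c + c * st c"] by (rule dd2)
  finally show "st c * c + c * st c = (?x * ?x + ?x * ?x) + (?y * ?y + ?y * ?y)" by simp
qed

text \<open>With \<open>s = h * h + st c * c\<close>, the element \<open>c * st c\<close> is a sum
  of squares minus \<open>s\<close>, hence at least \<open>- norm s\<close>. By the swap so is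
  \<open>st c * c\<close>, and \<open>- (h * h) = st c * c - s\<close> is at least
  \<open>- 2 * norm s\<close>. So both shifts of \<open>h * h\<close> are controlled, and 32 is
  twice the 16 of \<open>norm_sq_le_of_shifts\<close>.\<close>

lemma norm_square_le_norm_sum_selfadjoint:
  assumes h: "st h = h" shows "(norm h)\<^sup>2 \<le> 32 * norm (h * h + st c * c)"
proof (cases "h = 0")
  case False
  define s where "s = h * h + st c * c"
  obtain x y where xy: "st x = x" "st y = y" "st c * c + c * st c = (x * x + x * x) + (y * y + y * y)"
    by (rule mult_st_swap_decompose)
  note sq = almost_positive_square
  have "c * st c = ((st c * c + c * st c) + h * h) + (- s)" by (simp add: s_def)
  then have "c * st c = (((x * x + x * x) + (y * y + y * y)) + h * h) + (- s)" unfolding xy(3) .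
  then have "almost_positive (c * st c) (norm s)"
    using almost_positive_add[OF almost_positive_add[OF almost_positive_add[OF
        almost_positive_add[OF sq[OF xy(1)] sq[OF xy(1)]]
        almost_positive_add[OF sq[OF xy(2)] sq[OF xy(2)]]] sq[OF h]] almost_positive_norm[of "- s"]]
    by simp
  then have "almost_positive (st c * c + (- s)) (norm s + norm (- s))"
    by (intro almost_positive_add almost_positive_swap almost_positive_norm) auto
  then have minus: "almost_positive (- (h * h)) (2 * norm s)"
    unfolding norm_minus_cancel mult_2 by (simp add: s_def)
  have "(norm h)\<^sup>2 / 16 \<le> 2 * norm s + \<eta>" if \<eta>: "\<eta> > 0" for \<eta>
  proof -
    obtain t0 where t0: "norm (t *\<^sub>R z + h * h * z) \<le> (t + 2 * norm s + \<eta>) * norm z" if "t \<ge> t0" for t z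
      using minus[unfolded almost_positive_def, rule_format, OF \<eta>] by simp blast
    obtain t1 where t1: "norm (t *\<^sub>R z - h * h * z) \<le> (t + 0 + \<eta>) * norm z" if "t \<ge> t1" for t z
      using sq[OF h] \<eta> unfolding almost_positive_def by blast
    \<comment> \<open>As \<open>h\<close> is nonzero, \<open>T\<close> can pass both thresholds
      while being an even multiple of \<open>(norm h)\<^sup>2\<close>.\<close>
    obtain k :: nat where "max 1 (max t0 t1) / (norm h)\<^sup>2 < k" using reals_Archimedean2 by blast
    then have k: "max 1 (max t0 t1) < k * (norm h)\<^sup>2" using False by (simp add: field_simps)
    define T where "T = 2 * real k * (norm h)\<^sup>2"
    have T: "T \<ge> t0" "T \<ge> t1" "T \<ge> 0" using k by (auto simp: T_def)
    have "(norm h)\<^sup>2 \<le> 16 * (2 * norm s + \<eta>)"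
    proof (rule norm_sq_le_of_shifts[OF h _ T_def])
      show "k > 0" using k by (cases k) auto
      show "pn h [:T,0,1:] \<le> T + (2 * norm s + \<eta>)"
        using t0[OF T(1)] T \<eta> by (intro pn_le) (auto simp: mult.assoc add.assoc)
      show "pn h [:T,0,-1:] \<le> T + (2 * norm s + \<eta>)"
      proof (rule pn_le)
        fix z
        have "norm (T *\<^sub>R z - h * h * z) \<le> (T + (2 * norm s + \<eta>)) * norm z"
          by (rule order_trans[OF t1[OF T(2)] mult_right_mono]) auto
        then show "norm (pev h [:T,0,-1:] z) \<le> (T + (2 * norm s + \<eta>)) * norm z"
          by (simp add: mult.assoc)
      qed (use T \<eta> in auto)
    qed (use \<eta> in auto)
    then show ?thesis by simp
  qed
  then have "(norm h)\<^sup>2 / 16 \<le> 2 * norm s" by (rule field_le_epsilon)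
  then show ?thesis by (simp add: s_def)
qed simp

text \<open>Conjugating by \<open>a\<^sup>*\<close> reduces to self-adjoint \<open>h = a a\<^sup>*\<close>:
  \<open>h\<^sup>2 + (b a\<^sup>*)\<^sup>* (b a\<^sup>*) = a (a\<^sup>* a + b\<^sup>* b) a\<^sup>*\<close>.\<close>
lemma norm_st_mult_le_norm_sum: "norm (st a * a) \<le> 32 * norm (st a * a + st b * b)"
proof (cases "a = 0")
  case False
  let ?h = "a * st a" and ?s = "st a * a + st b * b"
  have h: "st ?h = ?h" by (simp add: st_mult)
  have nh: "norm ?h = (norm a)\<^sup>2" using norm_st_mult[of "st a"] by simp
  have "?h * ?h + st (b * st a) * (b * st a) = a * ?s * st a"
    by (simp add: st_mult algebra_simps)
  then have "((norm a)\<^sup>2)\<^sup>2 \<le> 32 * norm (a * ?s * st a)"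
    using norm_square_le_norm_sum_selfadjoint[OF h, of "b * st a"] by (simp add: nh)
  also have "norm (a * ?s * st a) \<le> norm a * norm ?s * norm a"
    using norm_mult_ineq[of "a * ?s" "st a"] norm_mult_ineq[of a ?s]
    by (smt (verit) mult_right_mono norm_ge_zero norm_st)
  finally have "(norm a)\<^sup>2 * (norm a)\<^sup>2 \<le> (norm a)\<^sup>2 * (32 * norm ?s)"
    by (simp add: power2_eq_square mult_ac)
  then have "(norm a)\<^sup>2 \<le> 32 * norm ?s" by (rule mult_left_le_imp_le) (use False in simp)
  then show ?thesis by (simp only: norm_st_mult)
qed simp

end

section \<open>Hilbert modules\<close>

locale hilbert_mod =
  fixes cB :: "complex \<Rightarrow> 'b::{banach,real_normed_algebra} \<Rightarrow> 'b" and st :: "'b \<Rightarrow> 'b"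
    and cE :: "complex \<Rightarrow> 'e::banach \<Rightarrow> 'e" and act :: "'e \<Rightarrow> 'b \<Rightarrow> 'e"
    and ip :: "'e \<Rightarrow> 'e \<Rightarrow> 'b"
  assumes hilbert_module: "hilbert_module cB st cE act ip"
begin

sublocale cstar cB st
  by unfold_locales (rule hilbert_module[unfolded hilbert_module_def, THEN conjunct1])

section \<open>Inner product and norm\<close>

lemma cE_of_real: "cE (complex_of_real r) x = r *\<^sub>R x"
  and ip_add_right: "ip x (y + z) = ip x y + ip x z"
  and ip_cE_right: "ip x (cE c y) = cB c (ip x y)"
proof -
  note * = hilbert_module[unfolded hilbert_module_def]
  have "\<forall>r x. cE (complex_of_real r) x = r *\<^sub>R x" using * by (elim conjE)
  then show "cE (complex_of_real r) x = r *\<^sub>R x" by blast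
  have "\<forall>x y z. ip x (y + z) = ip x y + ip x z" using * by (elim conjE)
  then show "ip x (y + z) = ip x y + ip x z" by blast
  have "\<forall>c x y. ip x (cE c y) = cB c (ip x y)" using * by (elim conjE)
  then show "ip x (cE c y) = cB c (ip x y)" by blast
qed

lemma ip_swap: "ip y x = st (ip x y)"
proof -
  have "\<forall>x y. ip y x = st (ip x y)" using hilbert_module unfolding hilbert_module_def by (elim conjE)
  then show ?thesis by blast
qed

lemma ip_self: "\<exists>b. ip x x = st b * b"
proof -
  have "\<forall>x. cstar_positive st (ip x x)" using hilbert_module unfolding hilbert_module_def by (elim conjE)
  then show ?thesis by (simp add: cstar_positive_def)
qed

lemma norm_ip_self: "norm (ip x x) = (norm x)\<^sup>2"
proof -
  have "\<forall>x. norm x = sqrt (norm (ip x x))" using hilbert_module unfolding hilbert_module_def by (elim conjE)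
  then have "norm x = sqrt (norm (ip x x))" by blast
  then show ?thesis using real_sqrt_pow2[of "norm (ip x x)"] by simp
qed

lemma ip_add_left: "ip (x + y) z = ip x z + ip y z"
  by (simp only: ip_swap[of _ z] ip_add_right st_add)

lemma ip_scaleR_right: "ip x (r *\<^sub>R y) = r *\<^sub>R ip x y"
  using ip_cE_right[of x "complex_of_real r" y] by (simp only: cE_of_real cB_of_real)

lemma ip_scaleR_left: "ip (r *\<^sub>R x) y = r *\<^sub>R ip x y"
  by (simp only: ip_swap[of _ y] ip_scaleR_right st_scaleR)

text \<open>Cauchy-Schwarz with a worse constant, from polarization alone: \<open>x + y\<close> and
  \<open>x - y\<close> bound the real part, \<open>\<i> y\<close> in place of \<open>y\<close> the
  imaginary part. Unit vectors give (1 + 1) squared = 4.\<close>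

lemma norm_ip_le: "norm (ip x y) \<le> 4 * norm x * norm y"
proof -
  have sym: "norm (ip x y + ip y x) \<le> (norm x + norm y)\<^sup>2" for x y
  proof -
    have d: "ip u (- v) = - ip u v" "ip (- v) u = - ip v u" for u v
      using ip_scaleR_right[of u "- 1" v] ip_scaleR_left[of "- 1" v u] by simp_all
    have "2 *\<^sub>R (ip x y + ip y x) = ip (x + y) (x + y) - ip (x + - y) (x + - y)"
      by (simp only: ip_add_left ip_add_right d) (simp add: scaleR_2)
    then have "norm (2 *\<^sub>R (ip x y + ip y x)) \<le> (norm (x + y))\<^sup>2 + (norm (x + - y))\<^sup>2"
      using norm_triangle_ineq4[of "ip (x + y) (x + y)" "ip (x + - y) (x + - y)"] by (simp only: norm_ip_self)
    moreover have "(norm (x + y))\<^sup>2 \<le> (norm x + norm y)\<^sup>2" "(norm (x + - y))\<^sup>2 \<le> (norm x + norm y)\<^sup>2"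
      using norm_triangle_ineq[of x y] norm_triangle_ineq[of x "- y"] by (simp_all only: norm_minus_cancel power_mono norm_ge_zero)
    ultimately show ?thesis unfolding norm_scaleR by linarith
  qed
  have le: "norm (ip x y) \<le> (norm x + norm y)\<^sup>2" for x y
  proof -
    have ip_i: "ip (cE \<i> y) z = - cB \<i> (ip y z)" for z y
    proof -
      have "ip (cE \<i> y) z = cB (- 1 * \<i>) (ip y z)"
        by (simp add: ip_swap[of _ z] ip_cE_right st_cB)
      then show ?thesis by (simp only: cB_cB[symmetric] cB_uminus)
    qed
    \<comment> \<open>The norm of a complex multiple is read off from the inner product.\<close>
    have "(norm (cE \<i> y))\<^sup>2 = (norm y)\<^sup>2"
      by (simp only: norm_ip_self[symmetric] ip_cE_right ip_i norm_cB norm_minus_cancel) simp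
    then have ni: "norm (cE \<i> y) = norm y" by simp
    have "ip x (cE \<i> y) + ip (cE \<i> y) x = cB \<i> (ip x y - ip y x)"
      by (simp add: ip_i ip_cE_right cB_diff)
    then have "norm (ip x y - ip y x) \<le> (norm x + norm y)\<^sup>2"
      using sym[of x "cE \<i> y"] by (simp add: norm_cB ni)
    moreover have "2 *\<^sub>R ip x y = (ip x y + ip y x) + (ip x y - ip y x)" by (simp add: scaleR_2)
    then have "norm (2 *\<^sub>R ip x y) \<le> norm (ip x y + ip y x) + norm (ip x y - ip y x)"
      by (simp only: norm_triangle_ineq)
    ultimately show ?thesis using sym[of x y] by simp
  qed
  show ?thesis
  proof (cases "x = 0 \<or> y = 0")
    case True
    then show ?thesis using ip_scaleR_left[of 0 x y] ip_scaleR_right[of x 0 y] by auto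
  next
    case False
    let ?x = "(1 / norm x) *\<^sub>R x" and ?y = "(1 / norm y) *\<^sub>R y"
    have "norm (ip ?x ?y) \<le> 4" using le[of ?x ?y] False by simp
    then show ?thesis using False by (simp add: ip_scaleR_left ip_scaleR_right field_simps)
  qed
qed

sublocale ip: bounded_bilinear ip
proof
  show "\<exists>K. \<forall>a b. norm (ip a b) \<le> norm a * norm b * K"
    using norm_ip_le by (intro exI[of _ 4]) (simp add: mult_ac)
qed (simp_all only: ip_add_left ip_add_right ip_scaleR_left ip_scaleR_right)

text \<open>Replaces monotonicity of the norm on positive elements: the two terms of a vanishing or
  small sum cannot cancel.\<close>

lemma norm_sq_le_norm_ip_sum: "(norm x)\<^sup>2 \<le> 32 * norm (ip x x + ip y y)"
proof -
  obtain a b where "ip x x = st a * a" "ip y y = st b * b" using ip_self by blast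
  then show ?thesis using norm_st_mult_le_norm_sum[of a b] by (simp only: norm_ip_self[symmetric])
qed

lemma ip_eq_0_dense:
  assumes "closure S = UNIV" "\<And>x. x \<in> S \<Longrightarrow> ip x z = 0" shows "z = 0"
proof -
  obtain s where s: "\<And>n. s n \<in> S" "s \<longlonglongrightarrow> z" using assms(1) closure_sequential[of z S] by auto
  have "(\<lambda>n. ip (s n) z) \<longlonglongrightarrow> ip z z" by (intro ip.tendsto s tendsto_const)
  then have "(\<lambda>n. 0) \<longlonglongrightarrow> ip z z" by (simp only: assms(2)[OF s(1)])
  then have "ip z z = 0" using LIMSEQ_unique tendsto_const by blast
  then show ?thesis using norm_ip_self[of z] by simp
qed

end

section \<open>Regular symmetric operators\<close>

text \<open>Turns an a priori estimate into convergence of preimages, so that dense range becomes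
  full range.\<close>

lemma convergent_if_differences_dominated:
  fixes x :: "nat \<Rightarrow> 'a::banach" and u :: "nat \<Rightarrow> 'c::real_normed_vector"
  assumes "convergent u" and le: "\<And>m n. norm (x m - x n) \<le> K * norm (u m - u n)"
  shows "convergent x"
proof -
  have "Cauchy x"
  proof (rule CauchyI)
    fix e :: real assume "e > 0"
    then have "e / (\<bar>K\<bar> + 1) > 0" by simp
    then obtain M where M: "\<And>m n. m \<ge> M \<Longrightarrow> n \<ge> M \<Longrightarrow> norm (u m - u n) < e / (\<bar>K\<bar> + 1)"
      using CauchyD[OF convergent_Cauchy[OF assms(1)]] by blast
    have "norm (x m - x n) < e" if "m \<ge> M" "n \<ge> M" for m n
    proof -
      have "norm (x m - x n) \<le> (\<bar>K\<bar> + 1) * norm (u m - u n)"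
        by (rule order_trans[OF le mult_right_mono]) auto
      also have "\<dots> < e" using M[OF that] by (simp add: field_simps)
      finally show ?thesis .
    qed
    then show "\<exists>M. \<forall>m\<ge>M. \<forall>n\<ge>M. norm (x m - x n) < e" by blast
  qed
  then show ?thesis by (simp add: Cauchy_convergent_iff)
qed

locale regular_symmetric = hilbert_mod cB st cE act ip
  for cB :: "complex \<Rightarrow> 'b::{banach,real_normed_algebra} \<Rightarrow> 'b" and st :: "'b \<Rightarrow> 'b"
    and cE :: "complex \<Rightarrow> 'e::banach \<Rightarrow> 'e" and act :: "'e \<Rightarrow> 'b \<Rightarrow> 'e"
    and ip :: "'e \<Rightarrow> 'e \<Rightarrow> 'b" +
  fixes D :: "'e oper"
  assumes regular: "regular cE act ip D" and symmetric: "symmetric_op cE act ip D"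
begin

abbreviation dom :: "'e set" where "dom \<equiv> fst D"
abbreviation T :: "'e \<Rightarrow> 'e" where "T \<equiv> snd D"

text \<open>The graph of \<open>D*\<close> as a relation, free of the choice in
  \<open>adjoint\<close>; density of \<open>dom\<close> makes it single-valued.\<close>

definition adj :: "'e \<Rightarrow> 'e \<Rightarrow> bool" where
  "adj y z \<longleftrightarrow> (\<forall>x\<in>dom. ip (T x) y = ip x z)"

lemma dense: "closure dom = UNIV" and is_operator: "is_operator cE act D"
  using symmetric by (simp_all add: symmetric_op_def densely_defined_def)

lemma dom_add: "x \<in> dom \<Longrightarrow> y \<in> dom \<Longrightarrow> x + y \<in> dom \<and> T (x + y) = T x + T y"
  using is_operator by (simp add: is_operator_def)

lemma dom_diff: assumes "x \<in> dom" "y \<in> dom" shows "x - y \<in> dom \<and> T (x - y) = T x - T y"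
proof -
  have "cE (- 1) v = - v" for v using cE_of_real[of "-1" v] by simp
  moreover have "cE (- 1) y \<in> dom \<and> T (cE (- 1) y) = cE (- 1) (T y)"
    using is_operator assms(2) unfolding is_operator_def by blast
  ultimately have "- y \<in> dom \<and> T (- y) = - T y" by simp
  then show ?thesis using dom_add[OF assms(1), of "- y"] by simp
qed

lemma adj_unique: assumes "adj y z" "adj y z'" shows "z = z'"
proof -
  have "z - z' = 0"
    by (rule ip_eq_0_dense[OF dense]) (use assms in \<open>simp add: adj_def ip.diff_right\<close>)
  then show ?thesis by simp
qed

lemma fst_adjoint: "y \<in> fst (adjoint ip D) \<longleftrightarrow> (\<exists>z. adj y z)"
  by (simp add: adjoint_def adj_def)

lemma snd_adjoint: assumes "adj y z" shows "snd (adjoint ip D) y = z"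
proof -
  have "adj y (SOME z. adj y z)" by (rule someI[of "adj y", OF assms])
  then have "(SOME z. adj y z) = z" using adj_unique assms by blast
  then show ?thesis by (simp add: adjoint_def adj_def)
qed

lemma adj_T: assumes "x \<in> dom" shows "adj x (T x)"
proof -
  have "x \<in> fst (adjoint ip D)" "snd (adjoint ip D) x = T x"
    using symmetric assms by (auto simp: symmetric_op_def)
  then show ?thesis using fst_adjoint snd_adjoint by force
qed

lemma adj_diff: "adj y z \<Longrightarrow> adj y' z' \<Longrightarrow> adj (y - y') (z - z')"
  by (simp add: adj_def ip.diff_right)

lemma adj_sym: "adj y z \<Longrightarrow> x \<in> dom \<Longrightarrow> ip y (T x) = ip z x"
  unfolding adj_def ip_swap[of y "T x"] ip_swap[of z x] by simp

lemma adj_limit: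
  assumes "y \<longlonglongrightarrow> a" "z \<longlonglongrightarrow> b" "\<And>n. adj (y n) (z n)" shows "adj a b"
  unfolding adj_def
proof
  fix x assume x: "x \<in> dom"
  have lims: "(\<lambda>n. ip (T x) (y n)) \<longlonglongrightarrow> ip (T x) a" "(\<lambda>n. ip x (z n)) \<longlonglongrightarrow> ip x b"
    by (intro ip.tendsto assms(1,2) tendsto_const)+
  have "ip (T x) (y n) = ip x (z n)" for n using assms(3) x by (simp add: adj_def)
  then show "ip (T x) a = ip x b" using LIMSEQ_unique[OF lims(1)] lims(2) by simp
qed

lemma T_limit:
  assumes "x \<longlonglongrightarrow> a" "(\<lambda>n. T (x n)) \<longlonglongrightarrow> b" "\<And>n. x n \<in> dom" shows "a \<in> dom \<and> T a = b"
proof -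
  have "closed (graph_of D)" using regular by (simp add: regular_def closed_op_def)
  moreover have "(x n, T (x n)) \<in> graph_of D" for n using assms(3) by (auto simp: graph_of_def)
  ultimately have "(a, b) \<in> graph_of D"
    using tendsto_Pair[OF assms(1,2)] by (rule closed_sequentially)
  then show ?thesis by (auto simp: graph_of_def)
qed

lemma op_closure: "fst (op_closure D) = dom" "x \<in> dom \<Longrightarrow> snd (op_closure D) x = T x"
proof -
  have "closed (graph_of D)" using regular by (simp add: regular_def closed_op_def)
  then have cl: "closure (graph_of D) = graph_of D" by simp
  show "fst (op_closure D) = dom" "x \<in> dom \<Longrightarrow> snd (op_closure D) x = T x"
    unfolding op_closure_def cl by (auto simp: graph_of_def)
qed

section \<open>Surjectivity of 1 + D*D and 1 + DD*\<close>

text \<open>Pairing \<open>x + D*D x\<close> with \<open>x\<close> gives the sum of the squares of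
  \<open>x\<close> and \<open>T x\<close>; 128 = 32 * 4 combines the two norm inequalities.\<close>

lemma one_plus_adj_T_bounds:
  assumes x: "x \<in> dom" and w: "adj (T x) w"
  shows "norm x \<le> 128 * norm (x + w)" "norm (T x) \<le> 128 * norm (x + w)"
proof -
  let ?u = "x + w"
  have eq: "ip x x + ip (T x) (T x) = ip x ?u" using w x by (simp add: adj_def ip.add_right)
  have le: "32 * norm (ip x ?u) \<le> 128 * norm x * norm ?u" using norm_ip_le[of x ?u] by simp
  have "norm x * norm x \<le> norm x * (128 * norm ?u)"
    using norm_sq_le_norm_ip_sum[of x "T x"] le unfolding eq by (simp add: power2_eq_square)
  then show 1: "norm x \<le> 128 * norm ?u" by (cases "x = 0") auto
  have "(norm (T x))\<^sup>2 \<le> 128 * norm x * norm ?u"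
    using norm_sq_le_norm_ip_sum[of "T x" x] le eq by (simp add: add.commute)
  also have "\<dots> \<le> 128 * (128 * norm ?u) * norm ?u" by (intro mult_right_mono mult_left_mono 1) auto
  also have "\<dots> = (128 * norm ?u)\<^sup>2" by (simp add: power2_eq_square)
  finally show "norm (T x) \<le> 128 * norm ?u" by (rule power2_le_imp_le) simp
qed

text \<open>The range is dense by regularity and closed by the estimates, since \<open>D\<close> and
  \<open>D*\<close> have closed graphs.\<close>

lemma one_plus_adj_T_surj: "\<exists>x\<in>dom. adj (T x) (u - x)"
proof -
  have "u \<in> closure {x + snd (adjoint ip D) (T x) | x. x \<in> dom \<and> T x \<in> fst (adjoint ip D)}"
    using regular by (simp add: regular_def)
  then obtain s where s: "\<And>n. s n \<in> {x + snd (adjoint ip D) (T x) | x. x \<in> dom \<and> T x \<in> fst (adjoint ip D)}"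
    and su: "s \<longlonglongrightarrow> u" unfolding closure_sequential by blast
  have "\<exists>x. x \<in> dom \<and> adj (T x) (s n - x)" for n
  proof -
    obtain x where x: "s n = x + snd (adjoint ip D) (T x)" "x \<in> dom" "T x \<in> fst (adjoint ip D)"
      using s[of n] by blast
    then show ?thesis using fst_adjoint snd_adjoint by force
  qed
  then obtain x where x: "\<And>n. x n \<in> dom" "\<And>n. adj (T (x n)) (s n - x n)" by metis
  have b: "norm (x m - x n) \<le> 128 * norm (s m - s n)"
    "norm (T (x m) - T (x n)) \<le> 128 * norm (s m - s n)" for m n
  proof -
    have d: "x m - x n \<in> dom" "T (x m - x n) = T (x m) - T (x n)" using dom_diff[OF x(1) x(1)] by auto
    have "(s m - x m) - (s n - x n) = (s m - s n) - (x m - x n)" by simp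
    then have "adj (T (x m - x n)) ((s m - s n) - (x m - x n))"
      using adj_diff[OF x(2)[of m] x(2)[of n]] unfolding d(2) by metis
    from one_plus_adj_T_bounds[OF d(1) this]
    show "norm (x m - x n) \<le> 128 * norm (s m - s n)"
      "norm (T (x m) - T (x n)) \<le> 128 * norm (s m - s n)"
      by (simp_all add: d(2))
  qed
  have "convergent s" using su by (auto simp: convergent_def)
  then obtain a t where at: "x \<longlonglongrightarrow> a" "(\<lambda>n. T (x n)) \<longlonglongrightarrow> t"
    using convergent_if_differences_dominated[of s x 128] b(1)
      convergent_if_differences_dominated[of s "\<lambda>n. T (x n)" 128] b(2) unfolding convergent_def by blast
  have "a \<in> dom" "T a = t" using T_limit[OF at x(1)] by auto
  moreover have "adj t (u - a)" by (rule adj_limit[OF at(2) tendsto_diff[OF su at(1)] x(2)])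
  ultimately show ?thesis by blast
qed

text \<open>The same estimate for \<open>z + DD* z\<close>, with \<open>x = D* z\<close>.\<close>

lemma one_plus_T_adj_bounds:
  assumes x: "x \<in> dom" and z: "adj z x"
  shows "norm x \<le> 128 * norm (z + T x)" "norm z \<le> 128 * norm (z + T x)"
proof -
  let ?v = "z + T x"
  have eq: "ip z z + ip x x = ip z ?v"
    using adj_sym[OF z x] by (simp add: ip.add_right)
  have le: "32 * norm (ip z ?v) \<le> 128 * norm z * norm ?v" using norm_ip_le[of z ?v] by simp
  have "norm z * norm z \<le> norm z * (128 * norm ?v)"
    using norm_sq_le_norm_ip_sum[of z x] le unfolding eq by (simp add: power2_eq_square)
  then show 1: "norm z \<le> 128 * norm ?v" by (cases "z = 0") auto
  have "(norm x)\<^sup>2 \<le> 128 * norm z * norm ?v"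
    using norm_sq_le_norm_ip_sum[of x z] le eq by (simp add: add.commute)
  also have "\<dots> \<le> 128 * (128 * norm ?v) * norm ?v" by (intro mult_right_mono mult_left_mono 1) auto
  also have "\<dots> = (128 * norm ?v)\<^sup>2" by (simp add: power2_eq_square)
  finally show "norm x \<le> 128 * norm ?v" by (rule power2_le_imp_le) simp
qed

text \<open>If \<open>v \<in> Dom D\<^sup>*\<close> and \<open>D\<^sup>* v = (1 + D\<^sup>* D) x\<close>, then \<open>z = v - D x\<close> satisfies \<open>D\<^sup>* z = x\<close>; so
  \<open>1 + D D\<^sup>*\<close> inherits its dense range from the density of \<open>Dom D\<^sup>*\<close>.\<close>
lemma one_plus_T_adj_surj: "\<exists>x\<in>dom. adj (v - T x) x"
proof -
  have "v \<in> closure (fst (adjoint ip D))"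
    using regular by (simp add: regular_def semi_regular_def densely_defined_def)
  then obtain s where s: "\<And>n. s n \<in> fst (adjoint ip D)" and sv: "s \<longlonglongrightarrow> v"
    unfolding closure_sequential by blast
  have "\<exists>x. x \<in> dom \<and> adj (s n - T x) x" for n
  proof -
    obtain w where w: "adj (s n) w" using s fst_adjoint by blast
    obtain x where x: "x \<in> dom" "adj (T x) (w - x)" using one_plus_adj_T_surj by blast
    show ?thesis using adj_diff[OF w x(2)] x(1) by auto
  qed
  then obtain x where x: "\<And>n. x n \<in> dom" "\<And>n. adj (s n - T (x n)) (x n)" by metis
  have b: "norm (x m - x n) \<le> 128 * norm (s m - s n)"
    "norm ((s m - T (x m)) - (s n - T (x n))) \<le> 128 * norm (s m - s n)" for m n
  proof -
    have d: "x m - x n \<in> dom" "T (x m - x n) = T (x m) - T (x n)" using dom_diff[OF x(1) x(1)] by auto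
    have e: "(s m - T (x m)) - (s n - T (x n)) + T (x m - x n) = s m - s n" by (simp add: d(2))
    show "norm (x m - x n) \<le> 128 * norm (s m - s n)"
      "norm ((s m - T (x m)) - (s n - T (x n))) \<le> 128 * norm (s m - s n)"
      using one_plus_T_adj_bounds[OF d(1) adj_diff[OF x(2)[of m] x(2)[of n]]] unfolding e by auto
  qed
  have "convergent s" using sv by (auto simp: convergent_def)
  then obtain a z where az: "x \<longlonglongrightarrow> a" "(\<lambda>n. s n - T (x n)) \<longlonglongrightarrow> z"
    using convergent_if_differences_dominated[of s x 128] b(1)
      convergent_if_differences_dominated[of s "\<lambda>n. s n - T (x n)" 128] b(2) unfolding convergent_def by blast
  have "(\<lambda>n. T (x n)) \<longlonglongrightarrow> v - z" using tendsto_diff[OF sv az(2)] by simp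
  then have "a \<in> dom" "T a = v - z" using T_limit[OF az(1) _ x(1)] by auto
  moreover have "adj z a" by (rule adj_limit[OF az(2,1) x(2)])
  ultimately show ?thesis by (intro bexI[of _ a]) auto
qed

text \<open>Both surjectivity statements together split the graph of \<open>D\<^sup>*\<close> orthogonally along the graph of \<open>D\<close>.\<close>
lemma adj_graph_decompose:
  assumes y: "adj y w"
  obtains x a b where "x \<in> dom" "y = x + a" "adj a b" "adj b (- a)"
proof -
  \<comment> \<open>\<open>p\<close> gives the projection of \<open>(y, 0)\<close> onto the graph of
    \<open>D\<close>, and \<open>q\<close> that of \<open>(0, w)\<close>; their sum is the
    \<open>x\<close> sought.\<close>
  obtain p where p: "p \<in> dom" "adj (T p) (y - p)" using one_plus_adj_T_surj by blast
  obtain q where q: "q \<in> dom" "adj (w - T q) q" using one_plus_T_adj_surj by blast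
  have pq: "p + q \<in> dom" "T (p + q) = T p + T q" using dom_add[OF p(1) q(1)] by auto
  show ?thesis
  proof
    show "adj (y - (p + q)) (w - T (p + q))" by (rule adj_diff[OF y adj_T[OF pq(1)]])
    show "adj (w - T (p + q)) (- (y - (p + q)))"
      using adj_diff[OF q(2) p(2)] by (simp add: pq(2) algebra_simps)
  qed (use pq in auto)
qed

text \<open>The pairs \<open>(a, b)\<close> in question form the orthogonal complement of the graph
  of \<open>D\<close> in that of \<open>D*\<close>; \<open>a = 0\<close> puts every \<open>y\<close>
  of the domain of \<open>D*\<close> into \<open>dom\<close>.\<close>

lemma self_adjointI:
  assumes "\<And>a b. adj a b \<Longrightarrow> adj b (- a) \<Longrightarrow> a = 0"
  shows "self_adjoint_op cE act ip D"
proof -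
  have "y \<in> dom" if "adj y w" for y w
    using adj_graph_decompose[OF that] assms by (metis add.right_neutral)
  then have "fst (adjoint ip D) = dom"
    using fst_adjoint adj_T by blast
  then show ?thesis using symmetric by (simp add: self_adjoint_op_def symmetric_op_def)
qed

lemma adequate_if_self_adjoint:
  assumes "self_adjoint_op cE act ip D" shows "adequate_approx_id ip D (\<lambda>_ x. x)"
proof -
  have "commutator D (\<lambda>x. x) = (\<lambda>_. 0)" by (simp add: commutator_def fun_eq_iff)
  then show ?thesis
    using assms unfolding adequate_approx_id_def seq_approx_id_def self_adjoint_end_def adjointable_def
      self_adjoint_op_def by (auto simp: op_closure(1) bounded_on_def intro!: exI[of _ 0])
qed

section \<open>Adequate approximate identities\<close>

context
  fixes \<phi> :: "nat \<Rightarrow> 'e \<Rightarrow> 'e"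
  assumes adequate: "adequate_approx_id ip D \<phi>"
begin

lemma \<phi>_sym: "ip (\<phi> k x) y = ip x (\<phi> k y)" and \<phi>_lim: "(\<lambda>k. \<phi> k x) \<longlonglongrightarrow> x"
  using adequate by (simp_all add: adequate_approx_id_def seq_approx_id_def self_adjoint_end_def)

lemma \<phi>_dom: "adj y w \<Longrightarrow> \<phi> k y \<in> dom"
  using adequate fst_adjoint unfolding adequate_approx_id_def op_closure(1) by blast

lemma commutator_eq: "x \<in> dom \<Longrightarrow> commutator D (\<phi> k) x = T (\<phi> k x) - \<phi> k (T x)"
  by (simp add: commutator_def op_closure \<phi>_dom[OF adj_T])

text \<open>Additivity follows from symmetry, by testing against all vectors.\<close>

lemma \<phi>_diff: "\<phi> k (x - y) = \<phi> k x - \<phi> k y"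
proof -
  have "\<phi> k (x - y) - (\<phi> k x - \<phi> k y) = 0"
    by (rule ip_eq_0_dense[of UNIV]) (simp_all add: ip.diff_right \<phi>_sym[symmetric])
  then show ?thesis by simp
qed

lemma commutator_diff:
  assumes "x \<in> dom" "y \<in> dom"
  shows "commutator D (\<phi> k) (x - y) = commutator D (\<phi> k) x - commutator D (\<phi> k) y"
  using dom_diff[OF assms] dom_diff[OF \<phi>_dom[OF adj_T] \<phi>_dom[OF adj_T], OF assms]
  by (simp add: commutator_eq assms \<phi>_diff)

text \<open>Individual boundedness makes the closure of each commutator single-valued and its
  \<open>op_norm\<close> a genuine supremum; the common bound on these norms then restricts to
  \<open>dom\<close>.\<close>

lemma commutator_uniform_bound:
  "\<exists>C. \<forall>k. \<forall>x\<in>dom. norm (commutator D (\<phi> k) x) \<le> C * norm x"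
proof -
  let ?c = "\<lambda>k. commutator D (\<phi> k)"
  let ?G = "\<lambda>k. graph_of (dom, ?c k)" and ?cl = "\<lambda>k. op_closure (dom, ?c k)"
  obtain C where C: "\<And>k. op_norm (?cl k) \<le> C"
    using adequate unfolding adequate_approx_id_def bdd_above_def by blast
  have "norm (?c k x) \<le> \<bar>C\<bar> * norm x" if x: "x \<in> dom" for k x
  proof -
    obtain K where K: "\<And>x. x \<in> dom \<Longrightarrow> norm (?c k x) \<le> K * norm x"
      using adequate unfolding adequate_approx_id_def bounded_on_def by blast
    \<comment> \<open>The Lipschitz bound passes to the closed graph; at \<open>a = a'\<close> it
      yields uniqueness of the value.\<close>
    have lip: "norm (b - b') \<le> K * norm (a - a')" if ab: "(a, b) \<in> closure (?G k)" "(a', b') \<in> closure (?G k)" for a b a' b'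
    proof -
      obtain s where s: "\<And>n. s n \<in> ?G k" "s \<longlonglongrightarrow> (a, b)" using ab(1) unfolding closure_sequential by blast
      obtain s' where s': "\<And>n. s' n \<in> ?G k" "s' \<longlonglongrightarrow> (a', b')" using ab(2) unfolding closure_sequential by blast
      have lims: "(\<lambda>n. norm (snd (s n) - snd (s' n))) \<longlonglongrightarrow> norm (b - b')"
        "(\<lambda>n. K * norm (fst (s n) - fst (s' n))) \<longlonglongrightarrow> K * norm (a - a')"
        using tendsto_fst[OF s(2)] tendsto_snd[OF s(2)] tendsto_fst[OF s'(2)] tendsto_snd[OF s'(2)]
        by (auto intro!: tendsto_intros)
      have "norm (snd (s n) - snd (s' n)) \<le> K * norm (fst (s n) - fst (s' n))" for n
      proof -
        obtain y y' where "s n = (y, ?c k y)" "y \<in> dom" "s' n = (y', ?c k y')" "y' \<in> dom"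
          using s(1)[of n] s'(1)[of n] by (auto simp: graph_of_def)
        then show ?thesis using K[of "y - y'"] dom_diff[of y y'] by (simp add: commutator_diff)
      qed
      then show ?thesis using lims by (intro LIMSEQ_le) auto
    qed
    have snd_cl: "snd (?cl k) a = b" if "(a, b) \<in> closure (?G k)" for a b
      unfolding op_closure_def snd_conv
    proof (rule the_equality)
      show "b' = b" if "(a, b') \<in> closure (?G k)" for b'
        using lip[OF \<open>(a, b) \<in> closure (?G k)\<close> that] by simp
    qed (rule that)
    have mem: "(y, ?c k y) \<in> closure (?G k)" if "y \<in> dom" for y
      using that closure_subset by (fastforce simp: graph_of_def)
    have "0 \<in> dom" using is_operator by (simp add: is_operator_def)
    \<comment> \<open>\<open>Sup\<close> bounds its members only if the set is bounded
      above.\<close>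
    have bdd: "bdd_above {norm (snd (?cl k) y) | y. y \<in> fst (?cl k) \<and> norm y \<le> 1}"
    proof (rule bdd_aboveI[of _ "\<bar>K\<bar>"], clarsimp)
      fix y assume "y \<in> fst (?cl k)" and ny: "norm y \<le> 1"
      then obtain b where b: "(y, b) \<in> closure (?G k)" by (auto simp: op_closure_def)
      have c0: "?c k 0 = 0" using commutator_diff[OF \<open>0 \<in> dom\<close> \<open>0 \<in> dom\<close>] by simp
      have "norm b \<le> K * norm y" using lip[OF b mem[OF \<open>0 \<in> dom\<close>]] by (simp add: c0)
      also have "\<dots> \<le> \<bar>K\<bar> * 1" using ny by (intro mult_mono) auto
      finally show "norm (snd (?cl k) y) \<le> \<bar>K\<bar>" by (simp add: snd_cl[OF b])
    qed
    have unit: "norm (?c k y) \<le> C" if y: "y \<in> dom" "norm y \<le> 1" for y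
    proof -
      have "y \<in> fst (?cl k)" using mem[OF y(1)] by (auto simp: op_closure_def)
      then have "norm (snd (?cl k) y) \<le> op_norm (?cl k)"
        unfolding op_norm_def using y bdd by (intro cSup_upper) auto
      then show ?thesis using C[of k] by (simp add: snd_cl[OF mem[OF y(1)]])
    qed
    show ?thesis
    proof (cases "x = 0")
      case True
      then show ?thesis using K[OF x] by simp
    next
      case False
      let ?r = "1 / norm x"
      have rx: "r *\<^sub>R x \<in> dom" "T (r *\<^sub>R x) = r *\<^sub>R T x" for r
        using is_operator x unfolding is_operator_def cE_of_real[symmetric] by blast+
      have \<phi>r: "\<phi> k (r *\<^sub>R y) = r *\<^sub>R \<phi> k y" for r y
      proof -
        have "\<phi> k (r *\<^sub>R y) - r *\<^sub>R \<phi> k y = 0"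
          by (rule ip_eq_0_dense[of UNIV]) (simp_all add: ip.diff_right ip_scaleR_right \<phi>_sym[symmetric])
        then show ?thesis by simp
      qed
      have "T (?r *\<^sub>R \<phi> k x) = ?r *\<^sub>R T (\<phi> k x)"
        using is_operator \<phi>_dom[OF adj_T[OF x]] unfolding is_operator_def cE_of_real[symmetric] by blast
      then have "?c k (?r *\<^sub>R x) = ?r *\<^sub>R ?c k x"
        by (simp add: commutator_eq x rx \<phi>r scaleR_diff_right)
      then have "?r * norm (?c k x) \<le> C" using unit[of "?r *\<^sub>R x"] rx False by simp
      then have "norm (?c k x) \<le> C * norm x" using False by (simp add: field_simps)
      also have "\<dots> \<le> \<bar>C\<bar> * norm x" by (simp add: mult_right_mono)
      finally show ?thesis .
    qed
  qed
  then show ?thesis by blast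
qed

text \<open>Identifies the formal adjoint of the commutator on the domain of \<open>D*\<close>;
  \<open>T (\<phi> k y)\<close> makes sense as \<open>\<phi> k\<close> maps that domain into
  \<open>dom\<close>.\<close>

lemma ip_commutator:
  assumes x: "x \<in> dom" and y: "adj y w"
  shows "ip (commutator D (\<phi> k) x) y = ip x (\<phi> k w - T (\<phi> k y))"
proof -
  have "ip (T (\<phi> k x)) y = ip x (\<phi> k w)"
    using y \<phi>_dom[OF adj_T[OF x]] by (simp add: adj_def \<phi>_sym)
  moreover have "ip (\<phi> k (T x)) y = ip x (T (\<phi> k y))"
    using adj_T[OF \<phi>_dom[OF y]] x by (simp add: adj_def \<phi>_sym)
  ultimately show ?thesis by (simp add: commutator_eq x ip.diff_left ip.diff_right)
qed

text \<open>By density the vector itself may be paired with itself in \<open>ip_commutator\<close>,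
  and one factor of its norm cancels.\<close>

lemma commutator_adjoint_uniform_bound:
  assumes y: "adj y w"
  shows "\<exists>C. \<forall>k. norm (\<phi> k w - T (\<phi> k y)) \<le> C"
proof -
  obtain C where C: "\<And>k x. x \<in> dom \<Longrightarrow> norm (commutator D (\<phi> k) x) \<le> C * norm x"
    using commutator_uniform_bound by blast
  have "norm (\<phi> k w - T (\<phi> k y)) \<le> 4 * \<bar>C\<bar> * norm y" for k
  proof -
    let ?v = "\<phi> k w - T (\<phi> k y)"
    obtain s where s: "\<And>n. s n \<in> dom" "s \<longlonglongrightarrow> ?v"
      using dense closure_sequential[of ?v dom] by auto
    have "norm (ip (s n) ?v) \<le> 4 * (\<bar>C\<bar> * norm (s n)) * norm y" for n
    proof -
      have "norm (commutator D (\<phi> k) (s n)) \<le> \<bar>C\<bar> * norm (s n)"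
        by (rule order_trans[OF C[OF s(1)] mult_right_mono]) auto
      then have "4 * norm (commutator D (\<phi> k) (s n)) * norm y \<le> 4 * (\<bar>C\<bar> * norm (s n)) * norm y"
        by (intro mult_right_mono mult_left_mono) auto
      then show ?thesis
        using norm_ip_le[of "commutator D (\<phi> k) (s n)" y] unfolding ip_commutator[OF s(1) y] by linarith
    qed
    moreover have "(\<lambda>n. norm (ip (s n) ?v)) \<longlonglongrightarrow> norm (ip ?v ?v)"
      by (intro tendsto_norm ip.tendsto s tendsto_const)
    moreover have "(\<lambda>n. 4 * (\<bar>C\<bar> * norm (s n)) * norm y) \<longlonglongrightarrow> 4 * (\<bar>C\<bar> * norm ?v) * norm y"
      by (intro tendsto_intros s)
    ultimately have "norm (ip ?v ?v) \<le> 4 * (\<bar>C\<bar> * norm ?v) * norm y"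
      by (intro LIMSEQ_le) auto
    then have "norm ?v * norm ?v \<le> norm ?v * (4 * \<bar>C\<bar> * norm y)"
      unfolding norm_ip_self by (simp add: power2_eq_square mult_ac)
    then show ?thesis by (cases "?v = 0") auto
  qed
  then show ?thesis by blast
qed

text \<open>Against \<open>x\<close> in \<open>dom\<close> the pairing tends to
  \<open>ip x w - ip (T x) y = 0\<close>; the uniform bound extends this to every
  \<open>b\<close>.\<close>

lemma commutator_adjoint_weakly_null:
  assumes y: "adj y w"
  shows "(\<lambda>k. ip b (\<phi> k w - T (\<phi> k y))) \<longlonglongrightarrow> 0"
proof (rule LIMSEQ_I)
  fix e :: real assume e: "e > 0"
  let ?v = "\<lambda>k. \<phi> k w - T (\<phi> k y)"
  obtain C where C: "\<And>k. norm (?v k) \<le> C" using commutator_adjoint_uniform_bound[OF y] by blast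
  then have C0: "C \<ge> 0" using norm_ge_zero order_trans by blast
  \<comment> \<open>Chosen so that \<open>4 * \<delta> * (C + 1) = e / 2\<close>, with 4 from
    \<open>norm_ip_le\<close>; adding 1 keeps the denominator positive.\<close>
  define \<delta> where "\<delta> = e / (8 * (C + 1))"
  have \<delta>: "\<delta> > 0" using e C0 by (simp add: \<delta>_def)
  have "b \<in> closure dom" by (simp add: dense)
  then obtain x where x: "x \<in> dom" "dist x b < \<delta>" using \<delta> closure_approachable by blast
  have "ip x (?v k) = ip (\<phi> k x) w - ip (\<phi> k (T x)) y" for k
  proof -
    have "ip x (T (\<phi> k y)) = ip (T x) (\<phi> k y)" using adj_T[OF \<phi>_dom[OF y]] x(1) by (simp add: adj_def)
    then show ?thesis by (simp add: ip.diff_right \<phi>_sym)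
  qed
  moreover have "(\<lambda>k. ip (\<phi> k x) w - ip (\<phi> k (T x)) y) \<longlonglongrightarrow> ip x w - ip (T x) y"
    by (intro tendsto_diff ip.tendsto \<phi>_lim tendsto_const)
  moreover have "ip x w - ip (T x) y = 0" using y x(1) by (simp add: adj_def)
  ultimately have "(\<lambda>k. ip x (?v k)) \<longlonglongrightarrow> 0" by simp
  then obtain N where N: "norm (ip x (?v k)) < e / 2" if "k \<ge> N" for k
    using LIMSEQ_D[of _ 0 "e / 2"] e by fastforce
  have "norm (ip b (?v k) - 0) < e" if "k \<ge> N" for k
  proof -
    have "norm (ip (b - x) (?v k)) \<le> 4 * \<delta> * (C + 1)"
      using x(2) C[of k] C0 \<delta>
      by (intro order_trans[OF norm_ip_le] mult_mono) (auto simp: dist_norm norm_minus_commute)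
    also have "\<dots> = e / 2"
    proof -
      have "C + 1 \<noteq> 0" using C0 by simp
      then show ?thesis unfolding \<delta>_def by (simp add: divide_simps del: distrib_left_numeral)
    qed
    finally show ?thesis
      using N[OF that] norm_triangle_ineq[of "ip (b - x) (?v k)" "ip x (?v k)"] by (simp add: ip.diff_left)
  qed
  then show "\<exists>N. \<forall>k\<ge>N. norm (ip b (?v k) - 0) < e" by blast
qed

lemma self_adjoint_if_adequate: "self_adjoint_op cE act ip D"
proof (rule self_adjointI)
  fix a b assume a: "adj a b" and b: "adj b (- a)"
  \<comment> \<open>The terms \<open>ip b (\<phi> k b)\<close> cancel, and \<open>D* b = - a\<close>
    gives \<open>ip b (T (\<phi> k a)) = - ip a (\<phi> k a)\<close>.\<close>
  have "ip a (\<phi> k a) + (ip b (\<phi> k b) - ip b (\<phi> k b - T (\<phi> k a))) = 0" for k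
    using adj_sym[OF b \<phi>_dom[OF a]] by (simp add: ip.diff_right ip.minus_left)
  moreover have "(\<lambda>k. ip a (\<phi> k a) + (ip b (\<phi> k b) - ip b (\<phi> k b - T (\<phi> k a)))) \<longlonglongrightarrow>
      ip a a + (ip b b - 0)"
    by (intro tendsto_add tendsto_diff ip.tendsto \<phi>_lim tendsto_const commutator_adjoint_weakly_null a)
  ultimately have "ip a a + ip b b = 0" using LIMSEQ_unique[OF _ tendsto_const] by simp
  then show "a = 0" using norm_sq_le_norm_ip_sum[of a b] by simp
qed

end

end

theorem mainTheorem4:
  fixes cB :: "complex \<Rightarrow> 'b::{banach,real_normed_algebra} \<Rightarrow> 'b"
    and st :: "'b \<Rightarrow> 'b"
    and cE :: "complex \<Rightarrow> 'e::banach \<Rightarrow> 'e"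
    and act :: "'e \<Rightarrow> 'b \<Rightarrow> 'e"
    and ip :: "'e \<Rightarrow> 'e \<Rightarrow> 'b"
    and D :: "'e oper"
  assumes "hilbert_module cB st cE act ip"
    and "regular cE act ip D"
    and "symmetric_op cE act ip D"
  shows "self_adjoint_op cE act ip D \<longleftrightarrow> (\<exists>\<phi>. adequate_approx_id ip D \<phi>)"
proof -
  interpret regular_symmetric cB st cE act ip D
    using assms by unfold_locales
  show ?thesis using adequate_if_self_adjoint self_adjoint_if_adequate by blast
qed

end
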